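(* Let $(\pi:\mathcal{G}\to M,\omega,G/P)$ be a Cartan geometry of type $(G,P)$ and let $D$ be a Dirac subalgebra of $\mathfrak g\ltimes\mathfrak g^*$. Then $F(D)$ is a Dirac structure in $T\mathcal{G}\oplus T^*\mathcal{G}$ if and only if $$\langle K(e_1,e_2),e_3\rangle+\langle K(e_2,e_3),e_1\rangle+\langle K(e_3,e_1),e_2\rangle=0$$ for all $e_1,e_2,e_3\in D$ (regarded as constant sections of $\mathcal{G}\times(\mathfrak g\oplus\mathfrak g^* )$; the identity is required at every point of $\mathcal{G}$).
   Context: A Cartan geometry $(\pi:\mathcal{G}\to M,\omega,G/P)$ of type $(G,P)$, where $G$ is a Lie group with Lie algebra $\mathfrak g$ and $P\subset G$ is a closed subgroup with Lie algebra $\mathfrak p$, is a principal $P$-bundle $\pi:\mathcal{G}\to M$ (right action $R_a$, $a\in P$) with a $\mathfrak g$-valued 1-form $\omega$ on $\mathcal{G}$ such that: (i) $\omega_u:T_u\mathcal{G}\to\mathfrak g$ is a linear isomorphism for every $u\in\mathcal{G}$; (ii) $R_a^*\omega=\mathrm{Ad}(a^{-1})\circ\omega$ for all $a\in P$; (iii) $\omega(\zeta_A)=A$ for all $A\in\mathfrak p$, where $\zeta_A$ is the fundamental vector field of $A$. Its curvature is the $\mathfrak g$-valued 2-form $\kappa=d\omega+\tfrac12[\omega,\omega]$ on $\mathcal{G}$, i.e. $\kappa(X,Y)=d\omega(X,Y)+[\omega(X),\omega(Y)]$. $\mathfrak g\oplus\mathfrak g^*$ carries the pairing $\langle A+\xi,B+\eta\rangle=\eta(A)+\xi(B)$,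 and $\mathfrak g\ltimes\mathfrak g^*$ denotes it with the Lie bracket $[A+\xi,B+\eta]=[A,B]+\mathrm{ad}_A^*\eta-\mathrm{ad}_B^*\xi$, where $(\mathrm{ad}_A^*\eta)(C)=-\eta([A,C])$. A Dirac subalgebra of $\mathfrak g\ltimes\mathfrak g^*$ is a Lie subalgebra that is a maximal isotropic subspace for $\langle\cdot,\cdot\rangle$. For a subspace $D\subset\mathfrak g\oplus\mathfrak g^*$, $F(D)\subset T\mathcal{G}\oplus T^*\mathcal{G}$ is the subbundle with fibres $F(D)_u=\{\omega_u^{-1}(A)+\omega_u^*(\xi): A+\xi\in D\}$, where $\omega_u^*(\xi)=\xi\circ\omega_u$. At $u\in\mathcal{G}$ define $K_u(A+\xi,B+\eta)=\kappa_u(\omega_u^{-1}(A),\omega_u^{-1}(B))\in\mathfrak g\subset\mathfrak g\oplus\mathfrak g^*$. For a manifold $N$, $TN\oplus T^*N$ carries the pairing $\langle X+\xi,Y+\eta\rangle=\eta(X)+\xi(Y)$ and the Courant bracket $[X+\xi,Y+\eta]=[X,Y]+L_X\eta-L_Y\xi-\tfrac12 d(\eta(X)-\xi(Y))$. A Dirac structure on $N$ is a maximal isotropic subbundle of $TN\oplus T^*N$ whose sections are closed under the Courant bracket. *)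

theory Defs
  imports "HOL-Analysis.Analysis" "HOL-Algebra.Group"
begin

section \<open>Smooth manifolds\<close>

text \<open>
  A manifold is an entire type \<open>'m\<close> (Hausdorff and second countable by its type classes) together
  with a smooth atlas. The model space is a real inner product space which is required to be
  finite dimensional; the class \<open>euclidean_space\<close> is not used because it excludes dimension 0.
  The inner product is only there to fix the topology, no notion below depends on it.
\<close>

definition finite_dim :: "'e::real_vector itself \<Rightarrow> bool" where
  "finite_dim _ \<longleftrightarrow> (\<exists>B::'e set. finite B \<and> span B = UNIV)"

primrec Ck_on :: "nat \<Rightarrow> 'e::real_normed_vector set \<Rightarrow> ('e \<Rightarrow> 'f::real_normed_vector) \<Rightarrow> bool" where
  "Ck_on 0 S f \<longleftrightarrow> continuous_on S f"
| "Ck_on (Suc k) S f \<longleftrightarrow>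
     (\<forall>x\<in>S. f differentiable (at x)) \<and> (\<forall>v. Ck_on k S (\<lambda>x. frechet_derivative f (at x) v))"

text \<open>Only meaningful on open sets, and only used for those.\<close>

definition smooth_on :: "'e::real_normed_vector set \<Rightarrow> ('e \<Rightarrow> 'f::real_normed_vector) \<Rightarrow> bool" where
  "smooth_on S f \<longleftrightarrow> (\<forall>k. Ck_on k S f)"

text \<open>A chart \<open>(U, \<phi>)\<close> consists of its domain and its coordinate map.\<close>

type_synonym ('m, 'e) chart = "'m set \<times> ('m \<Rightarrow> 'e)"
type_synonym ('m, 'e) atlas = "('m, 'e) chart set"

definition chart_image :: "('m, 'e) chart \<Rightarrow> 'e set" where
  "chart_image c = snd c ` fst c"

definition chart_inv :: "('m, 'e) chart \<Rightarrow> 'e \<Rightarrow> 'm" where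
  "chart_inv c = inv_into (fst c) (snd c)"

definition is_chart :: "('m::topological_space, 'e::real_inner) chart \<Rightarrow> bool" where
  "is_chart c \<longleftrightarrow> open (fst c) \<and> open (chart_image c) \<and>
     homeomorphism (fst c) (chart_image c) (snd c) (chart_inv c)"

definition smooth_manifold ::
  "('m::{t2_space,second_countable_topology}, 'e::real_inner) atlas \<Rightarrow> bool" where
  "smooth_manifold \<A> \<longleftrightarrow>
     finite_dim TYPE('e) \<and>
     (\<forall>c\<in>\<A>. is_chart c) \<and>
     (\<Union>c\<in>\<A>. fst c) = UNIV \<and>
     (\<forall>c\<in>\<A>. \<forall>d\<in>\<A>. smooth_on (snd c ` (fst c \<inter> fst d)) (snd d \<circ> chart_inv c))"

definition real_atlas :: "(real, real) atlas" where
  "real_atlas = {(UNIV, id)}"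

definition prod_atlas :: "('m, 'e) atlas \<Rightarrow> ('n, 'f) atlas \<Rightarrow> ('m \<times> 'n, 'e \<times> 'f) atlas" where
  "prod_atlas \<A> \<B> = (\<lambda>(c, d). (fst c \<times> fst d, map_prod (snd c) (snd d))) ` (\<A> \<times> \<B>)"

definition smooth_map_open ::
  "('m::topological_space, 'e::real_normed_vector) atlas \<Rightarrow>
   ('n::topological_space, 'f::real_normed_vector) atlas \<Rightarrow> 'm set \<Rightarrow> ('m \<Rightarrow> 'n) \<Rightarrow> bool" where
  "smooth_map_open \<A> \<B> W f \<longleftrightarrow> open W \<and> continuous_on W f \<and>
     (\<forall>c\<in>\<A>. \<forall>d\<in>\<B>. smooth_on (snd c ` (fst c \<inter> W \<inter> f -` fst d)) (snd d \<circ> f \<circ> chart_inv c))"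

text \<open>
  Smoothness on an arbitrary subset means existence of local smooth extensions. This is used for
  subsets involving the closed (hence embedded) subgroup \<open>P\<close>, where it is smoothness with
  respect to the submanifold structure.
\<close>

definition smooth_map ::
  "('m::topological_space, 'e::real_normed_vector) atlas \<Rightarrow>
   ('n::topological_space, 'f::real_normed_vector) atlas \<Rightarrow> 'm set \<Rightarrow> ('m \<Rightarrow> 'n) \<Rightarrow> bool" where
  "smooth_map \<A> \<B> S f \<longleftrightarrow>
     (\<forall>p\<in>S. \<exists>W g. p \<in> W \<and> smooth_map_open \<A> \<B> W g \<and> (\<forall>q\<in>W \<inter> S. g q = f q))"


section \<open>Tangent vectors, vector fields and differential forms\<close>

text \<open>
  Every point \<open>p\<close> gets a preferred chart \<open>chart_at \<A> p\<close> of the atlas, and \<open>T\<^sub>pM\<close> is the model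
  space \<open>'e\<close>, a vector being identified with its coordinates in the preferred chart at \<open>p\<close>.
  So a vector field is a function \<open>'m \<Rightarrow> 'e\<close> and a \<open>V\<close>-valued 1-form is a function
  \<open>'m \<Rightarrow> ('e \<Rightarrow>\<^sub>L V)\<close> (all linear maps are bounded in finite dimension), but smoothness has to be
  tested on their representatives with respect to a fixed chart.
\<close>

definition chart_at :: "('m, 'e) atlas \<Rightarrow> 'm \<Rightarrow> ('m, 'e) chart" where
  "chart_at \<A> p = (SOME c. c \<in> \<A> \<and> p \<in> fst c)"

definition tangent_map ::
  "('m, 'e::real_normed_vector) atlas \<Rightarrow> ('n, 'f::real_normed_vector) atlas \<Rightarrow>
   ('m \<Rightarrow> 'n) \<Rightarrow> 'm \<Rightarrow> 'e \<Rightarrow> 'f" where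
  "tangent_map \<A> \<B> f p =
     frechet_derivative (snd (chart_at \<B> (f p)) \<circ> f \<circ> chart_inv (chart_at \<A> p))
       (at (snd (chart_at \<A> p) p))"

definition velocity :: "('m, 'e::real_normed_vector) atlas \<Rightarrow> (real \<Rightarrow> 'm) \<Rightarrow> real \<Rightarrow> 'e" where
  "velocity \<A> \<gamma> t = vector_derivative (snd (chart_at \<A> (\<gamma> t)) \<circ> \<gamma>) (at t)"

definition coord_change ::
  "('m, 'e::real_normed_vector) chart \<Rightarrow> ('m, 'e) chart \<Rightarrow> 'm \<Rightarrow> 'e \<Rightarrow> 'e" where
  "coord_change c d p = frechet_derivative (snd d \<circ> chart_inv c) (at (snd c p))"

definition vf_rep ::
  "('m, 'e::real_normed_vector) atlas \<Rightarrow> ('m, 'e) chart \<Rightarrow> ('m \<Rightarrow> 'e) \<Rightarrow> 'e \<Rightarrow> 'e" where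
  "vf_rep \<A> c X x = (let p = chart_inv c x in coord_change (chart_at \<A> p) c p (X p))"

definition form_rep ::
  "('m, 'e::real_normed_vector) atlas \<Rightarrow> ('m, 'e) chart \<Rightarrow>
   ('m \<Rightarrow> 'e \<Rightarrow>\<^sub>L 'v::real_normed_vector) \<Rightarrow> 'e \<Rightarrow> 'e \<Rightarrow>\<^sub>L 'v" where
  "form_rep \<A> c \<alpha> x =
     (let p = chart_inv c x in \<alpha> p o\<^sub>L Blinfun (coord_change c (chart_at \<A> p) p))"

definition smooth_vector_field ::
  "('m::topological_space, 'e::real_normed_vector) atlas \<Rightarrow> 'm set \<Rightarrow> ('m \<Rightarrow> 'e) \<Rightarrow> bool" where
  "smooth_vector_field \<A> W X \<longleftrightarrow> (\<forall>c\<in>\<A>. smooth_on (snd c ` (fst c \<inter> W)) (vf_rep \<A> c X))"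

definition smooth_form ::
  "('m::topological_space, 'e::real_normed_vector) atlas \<Rightarrow> 'm set \<Rightarrow>
   ('m \<Rightarrow> 'e \<Rightarrow>\<^sub>L 'v::real_normed_vector) \<Rightarrow> bool" where
  "smooth_form \<A> W \<alpha> \<longleftrightarrow> (\<forall>c\<in>\<A>. smooth_on (snd c ` (fst c \<inter> W)) (form_rep \<A> c \<alpha>))"

text \<open>
  The following operations are given at \<open>p\<close> by their coordinate formulas in the preferred chart at
  \<open>p\<close>, the one in which the coordinates of a vector \<open>v \<in> T\<^sub>pM\<close> are \<open>v\<close> itself. The exterior
  derivative has the normalisation \<open>d\<alpha>(X,Y) = X\<alpha>(Y) - Y\<alpha>(X) - \<alpha>([X,Y])\<close>.
\<close>

definition lie_bracket ::
  "('m, 'e::real_normed_vector) atlas \<Rightarrow> ('m \<Rightarrow> 'e) \<Rightarrow> ('m \<Rightarrow> 'e) \<Rightarrow> 'm \<Rightarrow> 'e" where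
  "lie_bracket \<A> X Y p =
     (let c = chart_at \<A> p; x = snd c p
      in frechet_derivative (vf_rep \<A> c Y) (at x) (X p)
       - frechet_derivative (vf_rep \<A> c X) (at x) (Y p))"

definition d_form ::
  "('m, 'e::real_normed_vector) atlas \<Rightarrow> ('m \<Rightarrow> 'e \<Rightarrow>\<^sub>L 'v::real_normed_vector) \<Rightarrow>
   'm \<Rightarrow> 'e \<Rightarrow> 'e \<Rightarrow> 'v" where
  "d_form \<A> \<alpha> p v w =
     (let c = chart_at \<A> p; x = snd c p
      in frechet_derivative (form_rep \<A> c \<alpha>) (at x) v w
       - frechet_derivative (form_rep \<A> c \<alpha>) (at x) w v)"

definition d_fun ::
  "('m, 'e::real_normed_vector) atlas \<Rightarrow> ('m \<Rightarrow> real) \<Rightarrow> 'm \<Rightarrow> 'e \<Rightarrow>\<^sub>L real" where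
  "d_fun \<A> f p =
     (let c = chart_at \<A> p in Blinfun (frechet_derivative (f \<circ> chart_inv c) (at (snd c p))))"

text \<open>Lie derivative of a real 1-form, by Cartan's formula \<open>L\<^sub>X \<eta> = \<iota>\<^sub>X d\<eta> + d(\<eta>(X))\<close>.\<close>

definition lie_derivative ::
  "('m, 'e::real_normed_vector) atlas \<Rightarrow> ('m \<Rightarrow> 'e) \<Rightarrow> ('m \<Rightarrow> 'e \<Rightarrow>\<^sub>L real) \<Rightarrow>
   'm \<Rightarrow> 'e \<Rightarrow>\<^sub>L real" where
  "lie_derivative \<A> X \<eta> p =
     Blinfun (\<lambda>v. d_form \<A> \<eta> p (X p) v) + d_fun \<A> (\<lambda>q. \<eta> q (X q)) p"


section \<open>Dirac structures\<close>

text \<open>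
  \<open>V \<oplus> V\<^sup>*\<close> is the type \<open>'v \<times> ('v \<Rightarrow>\<^sub>L real)\<close>. This serves both for \<open>\<gg> \<oplus> \<gg>\<^sup>*\<close> and for the
  fibres of \<open>TN \<oplus> T\<^sup>*N\<close>.
\<close>

type_synonym 'v ddual = "'v \<times> ('v \<Rightarrow>\<^sub>L real)"

definition pairing :: "'v::real_normed_vector ddual \<Rightarrow> 'v ddual \<Rightarrow> real" where
  "pairing a b = snd b (fst a) + snd a (fst b)"

definition isotropic :: "'v::real_normed_vector ddual set \<Rightarrow> bool" where
  "isotropic D \<longleftrightarrow> subspace D \<and> (\<forall>a\<in>D. \<forall>b\<in>D. pairing a b = 0)"

definition maximal_isotropic :: "'v::real_normed_vector ddual set \<Rightarrow> bool" where
  "maximal_isotropic D \<longleftrightarrow> isotropic D \<and> (\<forall>E. isotropic E \<and> D \<subseteq> E \<longrightarrow> E = D)"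

definition courant_bracket ::
  "('m, 'e::real_normed_vector) atlas \<Rightarrow> ('m \<Rightarrow> 'e ddual) \<Rightarrow> ('m \<Rightarrow> 'e ddual) \<Rightarrow> 'm \<Rightarrow> 'e ddual" where
  "courant_bracket \<A> s t p =
     (let X = (\<lambda>q. fst (s q)); \<xi> = (\<lambda>q. snd (s q)); Y = (\<lambda>q. fst (t q)); \<eta> = (\<lambda>q. snd (t q))
      in (lie_bracket \<A> X Y p,
          lie_derivative \<A> X \<eta> p - lie_derivative \<A> Y \<xi> p
            - (1/2) *\<^sub>R d_fun \<A> (\<lambda>q. \<eta> q (X q) - \<xi> q (Y q)) p))"

definition smooth_section ::
  "('m::topological_space, 'e::real_normed_vector) atlas \<Rightarrow> 'm set \<Rightarrow> ('m \<Rightarrow> 'e ddual) \<Rightarrow> bool" where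
  "smooth_section \<A> W s \<longleftrightarrow>
     smooth_vector_field \<A> W (\<lambda>p. fst (s p)) \<and> smooth_form \<A> W (\<lambda>p. snd (s p))"

text \<open>A family of fibres is a (smooth) subbundle if it has smooth local frames.\<close>

definition subbundle ::
  "('m::topological_space, 'e::real_normed_vector) atlas \<Rightarrow> ('m \<Rightarrow> 'e ddual set) \<Rightarrow> bool" where
  "subbundle \<A> L \<longleftrightarrow>
     (\<forall>p. \<exists>W n (s :: nat \<Rightarrow> 'm \<Rightarrow> 'e ddual). open W \<and> p \<in> W \<and>
        (\<forall>i<n. smooth_section \<A> W (s i)) \<and>
        (\<forall>q\<in>W. inj_on (\<lambda>i. s i q) {..<n} \<and> independent ((\<lambda>i. s i q) ` {..<n}) \<and>
               span ((\<lambda>i. s i q) ` {..<n}) = L q))"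

definition section_of ::
  "('m::topological_space, 'e::real_normed_vector) atlas \<Rightarrow> ('m \<Rightarrow> 'e ddual set) \<Rightarrow>
   ('m \<Rightarrow> 'e ddual) \<Rightarrow> bool" where
  "section_of \<A> L s \<longleftrightarrow> smooth_section \<A> UNIV s \<and> (\<forall>p. s p \<in> L p)"

definition dirac_structure ::
  "('m::topological_space, 'e::real_normed_vector) atlas \<Rightarrow> ('m \<Rightarrow> 'e ddual set) \<Rightarrow> bool" where
  "dirac_structure \<A> L \<longleftrightarrow>
     subbundle \<A> L \<and> (\<forall>p. maximal_isotropic (L p)) \<and>
     (\<forall>s t. section_of \<A> L s \<and> section_of \<A> L t \<longrightarrow> section_of \<A> L (courant_bracket \<A> s t))"


section \<open>Lie groups\<close>

definition lie_group ::
  "('g::{t2_space,second_countable_topology}, 'l::real_inner) atlas \<Rightarrow> 'g monoid \<Rightarrow> bool" where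
  "lie_group \<A> G \<longleftrightarrow>
     smooth_manifold \<A> \<and> group G \<and> carrier G = UNIV \<and>
     smooth_map (prod_atlas \<A> \<A>) \<A> UNIV (\<lambda>(g, h). g \<otimes>\<^bsub>G\<^esub> h) \<and>
     smooth_map \<A> \<A> UNIV (m_inv G)"

text \<open>
  The Lie algebra \<open>\<gg>\<close> of \<open>G\<close> is \<open>T\<^sub>1G\<close>, that is the type \<open>'l\<close>, with the bracket of
  left-invariant vector fields.
\<close>

definition left_invariant ::
  "('g, 'l::real_normed_vector) atlas \<Rightarrow> 'g monoid \<Rightarrow> 'l \<Rightarrow> 'g \<Rightarrow> 'l" where
  "left_invariant \<A> G A g = tangent_map \<A> \<A> (\<lambda>h. g \<otimes>\<^bsub>G\<^esub> h) \<one>\<^bsub>G\<^esub> A"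

definition lie_algebra_bracket ::
  "('g, 'l::real_normed_vector) atlas \<Rightarrow> 'g monoid \<Rightarrow> 'l \<Rightarrow> 'l \<Rightarrow> 'l" where
  "lie_algebra_bracket \<A> G A B =
     lie_bracket \<A> (left_invariant \<A> G A) (left_invariant \<A> G B) \<one>\<^bsub>G\<^esub>"

definition Ad :: "('g, 'l::real_normed_vector) atlas \<Rightarrow> 'g monoid \<Rightarrow> 'g \<Rightarrow> 'l \<Rightarrow> 'l" where
  "Ad \<A> G a = tangent_map \<A> \<A> (\<lambda>g. a \<otimes>\<^bsub>G\<^esub> g \<otimes>\<^bsub>G\<^esub> m_inv G a) \<one>\<^bsub>G\<^esub>"

definition lie_exp ::
  "('g::topological_space, 'l::real_normed_vector) atlas \<Rightarrow> 'g monoid \<Rightarrow> 'l \<Rightarrow> 'g" where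
  "lie_exp \<A> G A =
     (THE \<gamma>. smooth_map real_atlas \<A> UNIV \<gamma> \<and> (\<forall>s t. \<gamma> (s + t) = \<gamma> s \<otimes>\<^bsub>G\<^esub> \<gamma> t) \<and>
             velocity \<A> \<gamma> 0 = A) 1"

definition lie_subalgebra_of ::
  "('g::topological_space, 'l::real_normed_vector) atlas \<Rightarrow> 'g monoid \<Rightarrow> 'g set \<Rightarrow> 'l set" where
  "lie_subalgebra_of \<A> G P = {A. \<forall>t::real. lie_exp \<A> G (t *\<^sub>R A) \<in> P}"

definition coad ::
  "('g, 'l::real_normed_vector) atlas \<Rightarrow> 'g monoid \<Rightarrow> 'l \<Rightarrow> ('l \<Rightarrow>\<^sub>L real) \<Rightarrow> 'l \<Rightarrow>\<^sub>L real" where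
  "coad \<A> G A \<eta> = Blinfun (\<lambda>C. - \<eta> (lie_algebra_bracket \<A> G A C))"

text \<open>The bracket of \<open>\<gg> \<ltimes> \<gg>\<^sup>*\<close>.\<close>

definition double_bracket ::
  "('g, 'l::real_normed_vector) atlas \<Rightarrow> 'g monoid \<Rightarrow> 'l ddual \<Rightarrow> 'l ddual \<Rightarrow> 'l ddual" where
  "double_bracket \<A> G a b =
     (lie_algebra_bracket \<A> G (fst a) (fst b),
      coad \<A> G (fst a) (snd b) - coad \<A> G (fst b) (snd a))"

definition dirac_subalgebra ::
  "('g, 'l::real_normed_vector) atlas \<Rightarrow> 'g monoid \<Rightarrow> 'l ddual set \<Rightarrow> bool" where
  "dirac_subalgebra \<A> G D \<longleftrightarrow>
     maximal_isotropic D \<and> (\<forall>a\<in>D. \<forall>b\<in>D. double_bracket \<A> G a b \<in> D)"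


section \<open>Cartan geometries\<close>

text \<open>
  The subgroup \<open>P\<close> is a subset of \<open>G\<close>; \<open>R u a\<close> is the right action of \<open>a\<close> on \<open>u\<close> and only
  matters for \<open>a \<in> P\<close>. A local trivialisation over \<open>V\<close> is given by its \<open>P\<close>-component \<open>\<Phi>\<close>.
\<close>

definition principal_bundle ::
  "('g::{t2_space,second_countable_topology}, 'l::real_inner) atlas \<Rightarrow> 'g monoid \<Rightarrow> 'g set \<Rightarrow>
   ('u::{t2_space,second_countable_topology}, 'e::real_inner) atlas \<Rightarrow>
   ('b::{t2_space,second_countable_topology}, 'f::real_inner) atlas \<Rightarrow>
   ('u \<Rightarrow> 'b) \<Rightarrow> ('u \<Rightarrow> 'g \<Rightarrow> 'u) \<Rightarrow> bool" where
  "principal_bundle \<A>G G P \<A>U \<A>M \<pi> R \<longleftrightarrow>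
     smooth_manifold \<A>U \<and> smooth_manifold \<A>M \<and>
     smooth_map \<A>U \<A>M UNIV \<pi> \<and>
     smooth_map (prod_atlas \<A>U \<A>G) \<A>U (UNIV \<times> P) (\<lambda>(u, a). R u a) \<and>
     (\<forall>u. R u \<one>\<^bsub>G\<^esub> = u) \<and>
     (\<forall>u. \<forall>a\<in>P. \<forall>b\<in>P. R (R u a) b = R u (a \<otimes>\<^bsub>G\<^esub> b)) \<and>
     (\<forall>u. \<forall>a\<in>P. \<pi> (R u a) = \<pi> u) \<and>
     (\<forall>x. \<exists>V \<Phi>. open V \<and> x \<in> V \<and>
        bij_betw (\<lambda>u. (\<pi> u, \<Phi> u)) (\<pi> -` V) (V \<times> P) \<and>
        smooth_map \<A>U (prod_atlas \<A>M \<A>G) (\<pi> -` V) (\<lambda>u. (\<pi> u, \<Phi> u)) \<and>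
        smooth_map (prod_atlas \<A>M \<A>G) \<A>U (V \<times> P) (inv_into (\<pi> -` V) (\<lambda>u. (\<pi> u, \<Phi> u))) \<and>
        (\<forall>u\<in>\<pi> -` V. \<forall>a\<in>P. \<Phi> (R u a) = \<Phi> u \<otimes>\<^bsub>G\<^esub> a))"

definition fundamental_field ::
  "('g::topological_space, 'l::real_normed_vector) atlas \<Rightarrow> 'g monoid \<Rightarrow>
   ('u, 'e::real_normed_vector) atlas \<Rightarrow> ('u \<Rightarrow> 'g \<Rightarrow> 'u) \<Rightarrow> 'l \<Rightarrow> 'u \<Rightarrow> 'e" where
  "fundamental_field \<A>G G \<A>U R A u = velocity \<A>U (\<lambda>t. R u (lie_exp \<A>G G (t *\<^sub>R A))) 0"

definition cartan_geometry ::
  "('g::{t2_space,second_countable_topology}, 'l::real_inner) atlas \<Rightarrow> 'g monoid \<Rightarrow> 'g set \<Rightarrow>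
   ('u::{t2_space,second_countable_topology}, 'e::real_inner) atlas \<Rightarrow>
   ('b::{t2_space,second_countable_topology}, 'f::real_inner) atlas \<Rightarrow>
   ('u \<Rightarrow> 'b) \<Rightarrow> ('u \<Rightarrow> 'g \<Rightarrow> 'u) \<Rightarrow> ('u \<Rightarrow> 'e \<Rightarrow>\<^sub>L 'l) \<Rightarrow> bool" where
  "cartan_geometry \<A>G G P \<A>U \<A>M \<pi> R \<omega> \<longleftrightarrow>
     lie_group \<A>G G \<and> subgroup P G \<and> closed P \<and>
     principal_bundle \<A>G G P \<A>U \<A>M \<pi> R \<and>
     smooth_form \<A>U UNIV \<omega> \<and>
     (\<forall>u. bij (blinfun_apply (\<omega> u))) \<and>
     (\<forall>a\<in>P. \<forall>u v. \<omega> (R u a) (tangent_map \<A>U \<A>U (\<lambda>u. R u a) u v) = Ad \<A>G G (m_inv G a) (\<omega> u v)) \<and>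
     (\<forall>A\<in>lie_subalgebra_of \<A>G G P. \<forall>u. \<omega> u (fundamental_field \<A>G G \<A>U R A u) = A)"

definition curvature ::
  "('g, 'l::real_normed_vector) atlas \<Rightarrow> 'g monoid \<Rightarrow> ('u, 'e::real_normed_vector) atlas \<Rightarrow>
   ('u \<Rightarrow> 'e \<Rightarrow>\<^sub>L 'l) \<Rightarrow> 'u \<Rightarrow> 'e \<Rightarrow> 'e \<Rightarrow> 'l" where
  "curvature \<A>G G \<A>U \<omega> u v w =
     d_form \<A>U \<omega> u v w + lie_algebra_bracket \<A>G G (\<omega> u v) (\<omega> u w)"

definition curvature_K ::
  "('g, 'l::real_normed_vector) atlas \<Rightarrow> 'g monoid \<Rightarrow> ('u, 'e::real_normed_vector) atlas \<Rightarrow>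
   ('u \<Rightarrow> 'e \<Rightarrow>\<^sub>L 'l) \<Rightarrow> 'u \<Rightarrow> 'l ddual \<Rightarrow> 'l ddual \<Rightarrow> 'l ddual" where
  "curvature_K \<A>G G \<A>U \<omega> u a b =
     (curvature \<A>G G \<A>U \<omega> u (inv_into UNIV (\<omega> u) (fst a)) (inv_into UNIV (\<omega> u) (fst b)), 0)"

definition F_bundle ::
  "('u \<Rightarrow> 'e::real_normed_vector \<Rightarrow>\<^sub>L 'l::real_normed_vector) \<Rightarrow> 'l ddual set \<Rightarrow> 'u \<Rightarrow> 'e ddual set" where
  "F_bundle \<omega> D u = {(inv_into UNIV (\<omega> u) A, \<xi> o\<^sub>L \<omega> u) | A \<xi>. (A, \<xi>) \<in> D}"

end

theory Submission
  imports Defs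
begin

text \<open>
  A section of \<open>F(D)\<close> is \<open>s = F(a)\<close> with a \<open>D\<close>-valued coefficient function \<open>a\<close>. For sections
  \<open>s = F(a)\<close>, \<open>t = F(b)\<close> and \<open>e \<in> D\<close>, compute \<open>\<langle>[s, t], F(e)\<rangle>\<close> at a point \<open>u\<close>. All
  terms with derivatives of \<open>a\<close> or \<open>b\<close> vanish, because these derivatives stay in \<open>D\<close>, which is
  isotropic; what remains is the cyclic sum of \<open>d\<omega>\<close>. As \<open>D\<close> is a subalgebra, \<open>d\<omega>\<close> may be
  replaced by \<open>\<kappa>\<close>, so \<open>\<langle>[s, t], F(e)\<rangle>\<close> is minus the cyclic sum of the theorem at
  \<open>(a(u), b(u), e)\<close>. Since a maximal isotropic subspace is its own orthogonal complement, \<open>[s, t]\<close> lies in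
  \<open>F(D)\<close> exactly if this vanishes for all \<open>e\<close>; constant \<open>a\<close>, \<open>b\<close> realise all triples.
\<close>

section \<open>Finite-dimensional spaces and isotropic subspaces\<close>

text \<open>Brackets and exterior derivatives are defined at each point in the chart preferred
  there, and this chart may jump from point to point. Differentiating along a section, or proving
  that a bracket of sections is smooth, therefore requires every formula in one fixed chart. Passing
  to it produces second derivatives of transition maps, which cancel because mixed derivatives
  commute; that symmetry is proved here in the form needed. The coefficient \<open>a\<close> is
  recovered from \<open>s\<close> by inverting \<open>\<omega>\<close>, so pointwise inversion of a
  smooth operator-valued map has to be shown smooth. Since \<open>Blinfun\<close> is meaningful only
  on bounded linear maps, each use of it also calls for a boundedness proof. Model spaces may have
  dimension 0; coordinates in them are expansions in a finite orthonormal family, possibly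
  empty.\<close>

lemma finite_dim_orthonormal_basis:
  assumes "finite_dim TYPE('e::real_inner)"
  obtains B :: "'e::real_inner set" where "finite B" "\<And>x. (\<Sum>b\<in>B. (x \<bullet> b) *\<^sub>R b) = x"
proof -
  obtain B0 :: "'e set" where "finite B0" "span B0 = UNIV"
    using assms unfolding finite_dim_def by auto
  then obtain C :: "'e set" where C: "finite C" "span C = UNIV" "pairwise orthogonal C"
    using basis_orthogonal[of B0] by metis
  \<comment> \<open>An orthogonal spanning set may contain the zero vector, which cannot be
    normalised and is dropped without changing the span.\<close>
  define B where "B = (\<lambda>x. x /\<^sub>R norm x) ` (C - {0})"
  have fin: "finite B" using C by (simp add: B_def)
  have nrm: "norm b = 1" if "b \<in> B" for b
  proof -
    obtain x where "x \<noteq> 0" "b = x /\<^sub>R norm x" using \<open>b \<in> B\<close> by (auto simp: B_def)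
    then show ?thesis by simp
  qed
  have orth: "a \<bullet> b = 0" if "a \<in> B" "b \<in> B" "a \<noteq> b" for a b
  proof -
    obtain x y where "x \<in> C" "y \<in> C" "a = x /\<^sub>R norm x" "b = y /\<^sub>R norm y"
      using \<open>a \<in> B\<close> \<open>b \<in> B\<close> unfolding B_def by blast
    moreover with that(3) have "x \<noteq> y" by auto
    ultimately show ?thesis using C(3) by (auto simp: pairwise_def orthogonal_def)
  qed
  have "C \<subseteq> span B"
  proof
    fix x assume x: "x \<in> C"
    show "x \<in> span B"
    proof (cases "x = 0")
      case False
      then have "x /\<^sub>R norm x \<in> B" using x by (auto simp: B_def)
      then have "norm x *\<^sub>R (x /\<^sub>R norm x) \<in> span B" by (intro span_scale span_base)
      then show ?thesis using False by simp
    qed (simp add: span_zero)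
  qed
  then have sp: "span B = UNIV" using C(2) by (metis span_mono span_span top.extremum_unique)
  have on_B: "(\<Sum>b\<in>B. (a \<bullet> b) *\<^sub>R b) = a" if "a \<in> B" for a
  proof -
    have "a \<bullet> a = 1" using nrm[OF that] by (simp add: norm_eq_1)
    then have "(\<Sum>b\<in>B. (a \<bullet> b) *\<^sub>R b) = (\<Sum>b\<in>B. if b = a then a else 0)"
      using orth[OF that] by (intro sum.cong) auto
    also have "\<dots> = a" using fin that by simp
    finally show ?thesis .
  qed
  have lin: "linear (\<lambda>x. \<Sum>b\<in>B. (x \<bullet> b) *\<^sub>R b)"
    by (intro bounded_linear.linear bounded_linear_sum bounded_linear_scaleR_const
        bounded_linear_inner_left)
  have "(\<Sum>b\<in>B. (x \<bullet> b) *\<^sub>R b) = id x" for x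
    by (rule linear_eq_on_span[OF lin linear_id, where B = B]) (use on_B sp in auto)
  with fin that[of B] show thesis by simp
qed

lemma linear_orthonormal_expansion:
  assumes "linear f" "\<And>x. (\<Sum>b\<in>B. (x \<bullet> b) *\<^sub>R b) = x"
  shows "(\<Sum>b\<in>B. (x \<bullet> b) *\<^sub>R f b) = f x"
  using arg_cong[OF assms(2)[of x], of f] assms(1) by (simp add: linear_sum linear_scale)

text \<open>Both sides agree on every vector after expanding it in \<open>B\<close>. This supplies
  the dual family that is used for smoothness of 1-forms and for a spanning set of
  \<open>'l ddual\<close>.\<close>

lemma functional_orthonormal_expansion:
  fixes f :: "'e::real_inner \<Rightarrow>\<^sub>L real"
  assumes "\<And>x. (\<Sum>b\<in>B. (x \<bullet> b) *\<^sub>R b) = x"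
  shows "(\<Sum>b\<in>B. f b *\<^sub>R blinfun_inner_left b) = f"
proof (rule blinfun_eqI)
  show "(\<Sum>b\<in>B. f b *\<^sub>R blinfun_inner_left b) v = f v" for v
    using arg_cong[OF assms[of v], of f]
    by (simp add: blinfun.bilinear_simps inner_commute mult.commute)
qed

text \<open>The expansion turns \<open>f\<close> into a finite sum of bounded maps
  \<open>x \<mapsto> (x \<bullet> b) *\<^sub>R f b\<close>. This is what makes
  \<open>Blinfun f\<close> evaluate to \<open>f\<close> for maps that are only known to be
  linear.\<close>

lemma finite_dim_bounded_linear:
  fixes f :: "'e::real_inner \<Rightarrow> 'v::real_normed_vector"
  assumes "finite_dim TYPE('e)" "linear f"
  shows "bounded_linear f"
proof -
  obtain B :: "'e set" where B: "finite B" "\<And>x. (\<Sum>b\<in>B. (x \<bullet> b) *\<^sub>R b) = x"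
    using finite_dim_orthonormal_basis[OF assms(1)] by blast
  have eq: "f = (\<lambda>x. \<Sum>b\<in>B. (x \<bullet> b) *\<^sub>R f b)"
    using linear_orthonormal_expansion[OF assms(2) B(2)] by (intro ext) simp
  show ?thesis
    by (subst eq) (intro bounded_linear_sum bounded_linear_scaleR_const bounded_linear_inner_left)
qed

text \<open>A basis of \<open>S\<close> stays independent after adjoining \<open>v\<close>, so some
  linear functional is 1 at \<open>v\<close> and 0 on that basis; finite dimension makes it
  bounded.\<close>

lemma finite_dim_separation:
  fixes S :: "'e::real_inner set"
  assumes "finite_dim TYPE('e)" "subspace S" "v \<notin> S"
  obtains \<zeta> :: "'e \<Rightarrow>\<^sub>L real" where "\<And>x. x \<in> S \<Longrightarrow> \<zeta> x = 0" "\<zeta> v \<noteq> 0"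
proof -
  obtain B where B: "B \<subseteq> S" "independent B" "S \<subseteq> span B"
    by (rule maximal_independent_subset[of S])
  then have spB: "span B = S"
    using assms(2) by (simp add: span_minimal subset_antisym)
  then have v: "v \<notin> span B" using assms(3) by simp
  then have "independent (insert v B)" using B(2) by (simp add: independent_insert)
  then obtain g :: "'e \<Rightarrow> real"
    where g: "linear g" "\<And>x. x \<in> insert v B \<Longrightarrow> g x = (if x = v then 1 else 0)"
    using linear_independent_extend[of "insert v B" "\<lambda>x. if x = v then 1 else 0"] by blast
  have "g x = 0" if "x \<in> S" for x
  proof (rule linear_eq_0_on_span[OF g(1)])
    show "x \<in> span B" using that spB by simp
    show "g b = 0" if "b \<in> B" for b using g(2)[of b] that v span_base[of b B] by auto
  qed
  moreover have "g v \<noteq> 0" using g(2)[of v] by simp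
  ultimately show thesis
    using that[of "Blinfun g"] finite_dim_bounded_linear[OF assms(1) g(1)]
    by (simp add: bounded_linear_Blinfun_apply)
qed

section \<open>The pairing and maximal isotropic subspaces\<close>

lemma pairing_commute: "pairing a b = pairing b a"
  by (simp add: pairing_def)

lemma pairing_linear:
  "pairing (a + a') b = pairing a b + pairing a' b"
  "pairing (r *\<^sub>R a) b = r * pairing a b"
  "pairing a (b + b') = pairing a b + pairing a b'"
  "pairing a (r *\<^sub>R b) = r * pairing a b"
  by (simp_all add: pairing_def blinfun.bilinear_simps algebra_simps)

text \<open>Adjoining \<open>v\<close> to \<open>D\<close> keeps all pairings zero, the mixed ones
  and the square of \<open>v\<close> by assumption, so maximality leaves no room for a larger
  space.\<close>

lemma maximal_isotropic_absorbs:
  assumes D: "maximal_isotropic D" and v: "\<And>d. d \<in> D \<Longrightarrow> pairing v d = 0" "pairing v v = 0"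
  shows "v \<in> D"
proof -
  have sub: "subspace D" and iso: "\<And>a b. a \<in> D \<Longrightarrow> b \<in> D \<Longrightarrow> pairing a b = 0"
    using D by (auto simp: maximal_isotropic_def isotropic_def)
  have v': "pairing d v = 0" if "d \<in> D" for d using v(1)[OF that] by (subst pairing_commute)
  let ?E = "span (insert v D)"
  have E: "\<exists>k. \<exists>d\<in>D. x = d + k *\<^sub>R v" if "x \<in> ?E" for x
  proof -
    obtain k where "x - k *\<^sub>R v \<in> span D" using \<open>x \<in> ?E\<close> unfolding span_insert by blast
    then have "x - k *\<^sub>R v \<in> D" using sub by (simp add: span_eq_iff[THEN iffD2])
    then show ?thesis by (metis diff_add_cancel)
  qed
  have "isotropic ?E"
    unfolding isotropic_def
  proof (intro conjI ballI)
    fix x y assume "x \<in> ?E" "y \<in> ?E"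
    then obtain k d l e where *: "d \<in> D" "x = d + k *\<^sub>R v" "e \<in> D" "y = e + l *\<^sub>R v"
      using E by meson
    show "pairing x y = 0"
      using *(1,3) v v' iso by (simp add: * pairing_linear)
  qed simp
  moreover have "D \<subseteq> ?E" by (meson span_superset subset_insertI subset_trans)
  ultimately have "?E = D" using D by (auto simp: maximal_isotropic_def)
  then show ?thesis by (metis insertI1 span_base)
qed

text \<open>
  A maximal isotropic \<open>D\<close> contains \<open>{0} \<times> Ann(pr\<^sub>1 D)\<close>; hence a vector orthogonal to \<open>D\<close> has its
  first component in \<open>pr\<^sub>1 D\<close>, and correcting it by an element of \<open>D\<close> lands it in this annihilator.
\<close>

lemma maximal_isotropic_perp_iff:
  fixes D :: "'l::real_inner ddual set"
  assumes fin: "finite_dim TYPE('l)" and D: "maximal_isotropic D"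
  shows "v \<in> D \<longleftrightarrow> (\<forall>d\<in>D. pairing v d = 0)"
proof
  show "\<forall>d\<in>D. pairing v d = 0" if "v \<in> D"
    using that D by (auto simp: maximal_isotropic_def isotropic_def)
next
  assume perp: "\<forall>d\<in>D. pairing v d = 0"
  have sub: "subspace D" and iso: "\<And>a b. a \<in> D \<Longrightarrow> b \<in> D \<Longrightarrow> pairing a b = 0"
    using D by (auto simp: maximal_isotropic_def isotropic_def)
  have sub1: "subspace (fst ` D)"
    using sub by (intro linear_subspace_image) (auto intro: linear_fst)
  have ann: "(0, \<xi>) \<in> D" if "\<And>A. A \<in> fst ` D \<Longrightarrow> blinfun_apply \<xi> A = 0" for \<xi>
    by (rule maximal_isotropic_absorbs[OF D]) (use that in \<open>auto simp: pairing_def\<close>)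
  have "fst v \<in> fst ` D"
  proof (rule ccontr)
    assume "fst v \<notin> fst ` D"
    then obtain \<zeta> :: "'l \<Rightarrow>\<^sub>L real" where z: "\<And>A. A \<in> fst ` D \<Longrightarrow> \<zeta> A = 0" "\<zeta> (fst v) \<noteq> 0"
      using finite_dim_separation[OF fin sub1] by blast
    have "pairing v (0, \<zeta>) = 0" using perp ann z(1) by blast
    then show False using z(2) by (simp add: pairing_def)
  qed
  then obtain d where d: "d \<in> D" "fst d = fst v" by auto
  have "(0, snd v - snd d) \<in> D"
  proof (rule ann)
    fix A assume "A \<in> fst ` D"
    then obtain e where e: "e \<in> D" "fst e = A" by auto
    have "pairing v e = 0" "pairing d e = 0" using perp iso d e by auto
    then show "(snd v - snd d) A = 0"
      using d(2) e(2) by (simp add: pairing_def blinfun.bilinear_simps)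
  qed
  then have "d + (0, snd v - snd d) \<in> D" using sub d by (intro subspace_add)
  moreover have "d + (0, snd v - snd d) = v" using d(2) by (simp add: prod_eq_iff)
  ultimately show "v \<in> D" by simp
qed

section \<open>Smooth functions on open sets\<close>

lemma frechet_derivative_eqI: "(f has_derivative f') (at x) \<Longrightarrow> frechet_derivative f (at x) = f'"
  using frechet_derivative_at by force

lemma Ck_on_cong:
  assumes "open S" "\<And>x. x \<in> S \<Longrightarrow> f x = g x" "Ck_on k S f"
  shows "Ck_on k S g"
  using assms(2,3)
proof (induction k arbitrary: f g)
  case 0
  then show ?case using continuous_on_cong by force
next
  case (Suc k)
  have d: "(g has_derivative frechet_derivative f (at x)) (at x)" if "x \<in> S" for x
    by (rule has_derivative_transform_within_open[of f _ _ _ S])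
       (use Suc.prems assms(1) that frechet_derivative_works in auto)
  have "Ck_on k S (\<lambda>x. frechet_derivative g (at x) v)" for v
    by (rule Suc.IH[of "\<lambda>x. frechet_derivative f (at x) v"])
       (use Suc.prems in \<open>auto simp: frechet_derivative_eqI[OF d]\<close>)
  then show ?case using d by (auto simp: differentiable_def)
qed

lemma Ck_on_SucD: "Ck_on (Suc k) S f \<Longrightarrow> Ck_on k S f"
proof (induction k arbitrary: f)
  case 0
  then show ?case
    by (auto intro!: continuous_at_imp_continuous_on differentiable_imp_continuous_within)
qed auto

lemma Ck_on_subset: "Ck_on k S f \<Longrightarrow> T \<subseteq> S \<Longrightarrow> Ck_on k T f"
  by (induction k arbitrary: f) (auto intro: continuous_on_subset)

text \<open>Allows the inductions on \<open>k\<close> to work with the explicit derivative given by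
  a differentiation rule in place of \<open>frechet_derivative\<close>.\<close>

lemma Ck_on_SucI:
  assumes "open S" "\<And>x. x \<in> S \<Longrightarrow> (f has_derivative f' x) (at x)" "\<And>v. Ck_on k S (\<lambda>x. f' x v)"
  shows "Ck_on (Suc k) S f"
proof -
  have "Ck_on k S (\<lambda>x. frechet_derivative f (at x) v)" for v
    by (rule Ck_on_cong[OF assms(1) _ assms(3)[of v]]) (simp add: frechet_derivative_eqI[OF assms(2)])
  then show ?thesis using assms(2) by (auto simp: differentiable_def)
qed

lemma Ck_on_SucE:
  assumes "Ck_on (Suc k) S f"
  shows "\<And>x. x \<in> S \<Longrightarrow> (f has_derivative frechet_derivative f (at x)) (at x)"
    "\<And>v. Ck_on k S (\<lambda>x. frechet_derivative f (at x) v)"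
  using assms frechet_derivative_works by auto

lemma Ck_on_const: "open S \<Longrightarrow> Ck_on k S (\<lambda>x. c)"
  by (induction k arbitrary: c) simp_all

lemma Ck_on_add:
  assumes "open S" "Ck_on k S f" "Ck_on k S g"
  shows "Ck_on k S (\<lambda>x. f x + g x)"
  using assms(2,3)
proof (induction k arbitrary: f g)
  case (Suc k)
  show ?case
    by (rule Ck_on_SucI[OF assms(1) has_derivative_add[OF Ck_on_SucE(1) Ck_on_SucE(1)]])
       (use Suc in auto)
qed (auto intro: continuous_intros)

lemma Ck_on_bounded_linear:
  assumes "open S" "Ck_on k S f" "bounded_linear L"
  shows "Ck_on k S (\<lambda>x. L (f x))"
  using assms(2)
proof (induction k arbitrary: f)
  case 0
  then show ?case using bounded_linear.continuous_on[OF assms(3)] by simp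
next
  case (Suc k)
  show ?case
    by (rule Ck_on_SucI[OF assms(1) bounded_linear.has_derivative[OF assms(3) Ck_on_SucE(1)]])
       (use Suc in auto)
qed

text \<open>By the Leibniz rule the derivative is a sum of two terms of the same bilinear shape,
  each with one factor differentiated, so the induction hypothesis applies to both. Scalar
  multiplication, evaluation and composition of operators are all instances.\<close>

lemma Ck_on_bilinear:
  assumes "bounded_bilinear m" "open S" "Ck_on k S f" "Ck_on k S g"
  shows "Ck_on k S (\<lambda>x. m (f x) (g x))"
  using assms(3,4)
proof (induction k arbitrary: f g)
  case 0
  then show ?case using bounded_bilinear.continuous_on[OF assms(1)] by simp
next
  case (Suc k)
  show ?case
  proof (rule Ck_on_SucI[OF assms(2) bounded_bilinear.FDERIV[OF assms(1) Ck_on_SucE(1) Ck_on_SucE(1)]])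
    show "Ck_on k S (\<lambda>x. m (f x) (frechet_derivative g (at x) v) + m (frechet_derivative f (at x) v) (g x))"
      for v
      by (intro Ck_on_add[OF assms(2)] Suc.IH Ck_on_SucE(2)[OF Suc.prems(1)] Ck_on_SucE(2)[OF Suc.prems(2)]
          Ck_on_SucD[OF Suc.prems(1)] Ck_on_SucD[OF Suc.prems(2)])
  qed (use Suc.prems in auto)
qed

section \<open>Closure properties of smooth maps\<close>

lemma smooth_onE:
  assumes "smooth_on S f"
  shows "\<And>x. x \<in> S \<Longrightarrow> (f has_derivative frechet_derivative f (at x)) (at x)"
    "\<And>v. smooth_on S (\<lambda>x. frechet_derivative f (at x) v)"
  using assms Ck_on_SucE[of _ S f] unfolding smooth_on_def by blast+

lemma smooth_on_cong:
  "open S \<Longrightarrow> (\<And>x. x \<in> S \<Longrightarrow> f x = g x) \<Longrightarrow> smooth_on S f \<Longrightarrow> smooth_on S g"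
  unfolding smooth_on_def using Ck_on_cong by blast

lemma smooth_on_subset: "smooth_on S f \<Longrightarrow> T \<subseteq> S \<Longrightarrow> smooth_on T f"
  unfolding smooth_on_def using Ck_on_subset by blast

lemma smooth_on_const: "open S \<Longrightarrow> smooth_on S (\<lambda>x. c)"
  by (simp add: smooth_on_def Ck_on_const)

lemma smooth_on_add:
  "open S \<Longrightarrow> smooth_on S f \<Longrightarrow> smooth_on S g \<Longrightarrow> smooth_on S (\<lambda>x. f x + g x)"
  by (simp add: smooth_on_def Ck_on_add)

lemma smooth_on_bounded_linear:
  "open S \<Longrightarrow> smooth_on S f \<Longrightarrow> bounded_linear L \<Longrightarrow> smooth_on S (\<lambda>x. L (f x))"
  by (simp add: smooth_on_def Ck_on_bounded_linear)

lemma smooth_on_bilinear: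
  "bounded_bilinear m \<Longrightarrow> open S \<Longrightarrow> smooth_on S f \<Longrightarrow> smooth_on S g \<Longrightarrow>
    smooth_on S (\<lambda>x. m (f x) (g x))"
  by (simp add: smooth_on_def Ck_on_bilinear)

lemma smooth_on_diff:
  assumes "open S" "smooth_on S f" "smooth_on S g"
  shows "smooth_on S (\<lambda>x. f x - g x)"
  using smooth_on_add[OF assms(1,2) smooth_on_bounded_linear[OF assms(1,3), of uminus]]
  by (simp add: bounded_linear_minus[OF bounded_linear_ident])

lemma smooth_on_sum:
  "open S \<Longrightarrow> (\<And>i. i \<in> I \<Longrightarrow> smooth_on S (f i)) \<Longrightarrow> smooth_on S (\<lambda>x. \<Sum>i\<in>I. f i x)"
  by (induction I rule: infinite_finite_induct) (auto intro: smooth_on_const smooth_on_add)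

text \<open>\<open>Ck_on\<close> speaks about derivatives in fixed directions. Expanding
  \<open>g x\<close> in \<open>B\<close> replaces the moving direction by finitely many fixed ones
  with smooth coefficients.\<close>

lemma smooth_on_derivative_apply:
  fixes f :: "'e::real_inner \<Rightarrow> 'v::real_normed_vector"
  assumes "finite_dim TYPE('e)" "open S" "smooth_on S f" "smooth_on S g"
  shows "smooth_on S (\<lambda>x. frechet_derivative f (at x) (g x))"
proof -
  obtain B :: "'e set" where B: "finite B" "\<And>x. (\<Sum>b\<in>B. (x \<bullet> b) *\<^sub>R b) = x"
    using finite_dim_orthonormal_basis[OF assms(1)] by blast
  have eq: "(\<Sum>b\<in>B. (g x \<bullet> b) *\<^sub>R frechet_derivative f (at x) b) = frechet_derivative f (at x) (g x)"
    if "x \<in> S" for x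
    using smooth_onE(1)[OF assms(3) that] by (intro linear_orthonormal_expansion[OF _ B(2)] has_derivative_linear)
  show ?thesis
    by (rule smooth_on_cong[OF assms(2) eq])
       (auto intro!: smooth_on_sum assms smooth_on_bilinear[OF bounded_bilinear_scaleR]
          smooth_onE(2) smooth_on_bounded_linear[OF _ _ bounded_linear_inner_left])
qed

text \<open>Smoothness in operator norm follows from pointwise smoothness because \<open>f x\<close>
  is a finite combination of fixed functionals with coefficients \<open>f x b\<close>.\<close>

lemma smooth_on_blinfunI:
  fixes f :: "'e::real_inner \<Rightarrow> 'e \<Rightarrow>\<^sub>L real"
  assumes "finite_dim TYPE('e)" "open S" "\<And>v. smooth_on S (\<lambda>x. f x v)"
  shows "smooth_on S f"
proof -
  obtain B :: "'e set" where B: "finite B" "\<And>x. (\<Sum>b\<in>B. (x \<bullet> b) *\<^sub>R b) = x"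
    using finite_dim_orthonormal_basis[OF assms(1)] by blast
  have eq: "(\<Sum>b\<in>B. f x b *\<^sub>R blinfun_inner_left b) = f x" for x
    by (rule functional_orthonormal_expansion[OF B(2)])
  show ?thesis
    by (rule smooth_on_cong[OF assms(2) eq])
       (auto intro!: smooth_on_sum assms smooth_on_bilinear[OF bounded_bilinear_scaleR] smooth_on_const)
qed

text \<open>A Leibniz rule in which \<open>h\<close> is merely continuous at \<open>x\<close>. As
  \<open>g\<close> vanishes at \<open>x\<close>, \<open>g y\<close> is of first order in
  \<open>y - x\<close>, so \<open>m (h y - h x) (g y)\<close> is of smaller order. It serves to
  differentiate an inverse before its differentiability is known.\<close>

lemma bilinear_has_derivative_vanishing:
  assumes m: "bounded_bilinear m" and h: "(h \<longlongrightarrow> h x) (at x)"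
    and g: "(g has_derivative g') (at x)" "g x = 0"
  shows "((\<lambda>y. m (h y) (g y)) has_derivative (\<lambda>v. m (h x) (g' v))) (at x)"
proof -
  obtain K where K: "\<And>a b. norm (m a b) \<le> norm a * norm b * K" "0 < K"
    using bounded_bilinear.pos_bounded[OF m] by auto
  obtain C where C: "\<And>v. norm (g' v) \<le> norm v * C"
    using bounded_linear.bounded[OF has_derivative_bounded_linear[OF g(1)]] by blast
  \<comment> \<open>The relative error of the linear approximation of \<open>g\<close>; together
    with the bound \<open>C\<close> of \<open>g'\<close> it gives
    \<open>norm (g y) \<le> (r y + C) * norm (y - x)\<close>.\<close>
  define r where "r y = norm (g y - g x - g' (y - x)) / norm (y - x)" for y
  have r: "(r \<longlongrightarrow> 0) (at x)"
    using g(1) unfolding has_derivative_iff_norm r_def by simp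
  have "((\<lambda>y. norm (h y - h x) * (r y + C) * K) \<longlongrightarrow> 0) (at x)"
    by (rule tendsto_eq_intros h r refl | simp)+
  moreover have "norm (m (h y - h x) (g y) - m (h x - h x) (g x) - 0) / norm (y - x)
      \<le> norm (h y - h x) * (r y + C) * K" if "y \<noteq> x" for y
  proof -
    have "norm (g y) \<le> norm (g y - g' (y - x)) + norm (g' (y - x))" by (metis diff_add_cancel norm_triangle_ineq)
    also have "\<dots> \<le> (r y + C) * norm (y - x)"
      using C[of "y - x"] that g(2) by (simp add: r_def field_simps)
    finally have "norm (m (h y - h x) (g y)) \<le> norm (h y - h x) * ((r y + C) * norm (y - x)) * K"
      by (intro order_trans[OF K(1)] mult_right_mono mult_left_mono) (use K(2) in auto)
    then show ?thesis
      using that g(2) by (simp add: bounded_bilinear.zero_right[OF m] field_simps)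
  qed
  ultimately have "((\<lambda>y. m (h y - h x) (g y)) has_derivative (\<lambda>v. 0)) (at x)"
    unfolding has_derivative_iff_norm
    by (auto intro!: Lim_null_comparison[of _ "\<lambda>y. norm (h y - h x) * (r y + C) * K"]
        simp: eventually_at_filter bounded_linear_zero)
  from has_derivative_add[OF this
      bounded_linear.has_derivative[OF bounded_bilinear.bounded_linear_right[OF m, of "h x"] g(1)]]
  show ?thesis by (simp add: bounded_bilinear.diff_left[OF m])
qed

text \<open>Everything rests on the resolvent identity \<open>J'\<close>, which is used twice: it
  shows that \<open>J\<close> is continuous at \<open>x\<close>, and it then has the form covered by
  \<open>bilinear_has_derivative_vanishing\<close>, with the factor
  \<open>\<Omega> y - \<Omega> x\<close> vanishing at \<open>x\<close>.\<close>

lemma blinfun_inverse_has_derivative: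
  fixes \<Omega> :: "'x::real_normed_vector \<Rightarrow> 'a::real_normed_vector \<Rightarrow>\<^sub>L 'b::real_normed_vector"
  assumes S: "open S" "x \<in> S"
    and inv: "\<And>y. y \<in> S \<Longrightarrow> J y o\<^sub>L \<Omega> y = id_blinfun" "\<And>y. y \<in> S \<Longrightarrow> \<Omega> y o\<^sub>L J y = id_blinfun"
    and d: "(\<Omega> has_derivative \<Omega>') (at x)"
  shows "(J has_derivative (\<lambda>v. - (J x o\<^sub>L (\<Omega>' v o\<^sub>L J x)))) (at x)"
proof -
  have J: "J y v = J x v - J y (\<Omega> y (J x v) - \<Omega> x (J x v))" if "y \<in> S" for y v
  proof -
    have "J y (\<Omega> y (J x v)) = J x v"
      using inv(1)[OF that] by (metis blinfun_apply_blinfun_compose blinfun_apply_id_blinfun id_apply)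
    moreover have "\<Omega> x (J x v) = v"
      using inv(2)[OF S(2)] by (metis blinfun_apply_blinfun_compose blinfun_apply_id_blinfun id_apply)
    ultimately show ?thesis by (simp add: blinfun.diff_right)
  qed
  have J': "J y = J x - (J y o\<^sub>L ((\<Omega> y - \<Omega> x) o\<^sub>L J x))" if "y \<in> S" for y
    by (rule blinfun_eqI, unfold blinfun.diff_left blinfun_apply_blinfun_compose) (rule J[OF that])
  have ev: "\<forall>\<^sub>F y in at x. y \<in> S"
    using S by (simp add: eventually_at_topological) blast
  have \<Omega>: "(\<Omega> \<longlongrightarrow> \<Omega> x) (at x)"
    using has_derivative_continuous[OF d] by (simp add: continuous_within)
  have lim0: "((\<lambda>y. norm (\<Omega> y - \<Omega> x) * norm (J x)) \<longlongrightarrow> 0) (at x)"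
    by (rule tendsto_eq_intros \<Omega> refl | simp)+
  \<comment> \<open>The threshold 1/2 yields
    \<open>norm (J y) \<le> norm (J x) + norm (J y) / 2\<close>, hence the bound
    \<open>2 * norm (J x)\<close> near \<open>x\<close> before any continuity of \<open>J\<close> is
    available.\<close>
  have "\<forall>\<^sub>F y in at x. norm (\<Omega> y - \<Omega> x) * norm (J x) < 1/2"
    using order_tendstoD(2)[OF lim0, of "1/2"] by simp
  then have "\<forall>\<^sub>F y in at x. norm (J y - J x) \<le> 2 * norm (J x) * (norm (\<Omega> y - \<Omega> x) * norm (J x))"
    using ev
  proof eventually_elim
    case (elim y)
    let ?t = "norm (\<Omega> y - \<Omega> x) * norm (J x)"
    have "J x - J y = J y o\<^sub>L ((\<Omega> y - \<Omega> x) o\<^sub>L J x)"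
      using J'[OF elim(2)] by (metis add_diff_cancel_left' diff_add_cancel)
    then have "norm (J y - J x) = norm (J y o\<^sub>L ((\<Omega> y - \<Omega> x) o\<^sub>L J x))"
      by (simp add: norm_minus_commute)
    also have "\<dots> \<le> norm (J y) * norm ((\<Omega> y - \<Omega> x) o\<^sub>L J x)" by (rule norm_blinfun_compose)
    also have "\<dots> \<le> norm (J y) * ?t" by (intro mult_left_mono norm_blinfun_compose norm_ge_zero)
    finally have 1: "norm (J y - J x) \<le> norm (J y) * ?t" .
    have "norm (J y) * ?t \<le> norm (J y) * (1/2)" using elim(1) by (intro mult_left_mono) auto
    moreover have "norm (J y) \<le> norm (J x) + norm (J y - J x)"
      by (metis add.commute diff_add_cancel norm_triangle_ineq)
    ultimately have "norm (J y) \<le> 2 * norm (J x)" using 1 by linarith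
    then have "norm (J y) * ?t \<le> 2 * norm (J x) * ?t" by (intro mult_right_mono) auto
    then show ?case using 1 by linarith
  qed
  moreover have "((\<lambda>y. 2 * norm (J x) * (norm (\<Omega> y - \<Omega> x) * norm (J x))) \<longlongrightarrow> 0) (at x)"
    by (rule tendsto_eq_intros lim0 refl | simp)+
  ultimately have "((\<lambda>y. J y - J x) \<longlongrightarrow> 0) (at x)"
    by (rule Lim_null_comparison)
  then have J_lim: "(J \<longlongrightarrow> J x) (at x)" by (simp add: LIM_zero_iff)
  have "((\<lambda>y. (\<Omega> y - \<Omega> x) o\<^sub>L J x) has_derivative (\<lambda>v. \<Omega>' v o\<^sub>L J x)) (at x)"
    using bounded_linear.has_derivative[OF bounded_bilinear.bounded_linear_left[OF bounded_bilinear_blinfun_compose, of "J x"]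
        has_derivative_diff[OF d has_derivative_const[of "\<Omega> x"]]] by simp
  from bilinear_has_derivative_vanishing[OF bounded_bilinear_blinfun_compose J_lim this]
  have "((\<lambda>y. J x - (J y o\<^sub>L ((\<Omega> y - \<Omega> x) o\<^sub>L J x))) has_derivative (\<lambda>v. 0 - (J x o\<^sub>L (\<Omega>' v o\<^sub>L J x)))) (at x)"
    by (intro has_derivative_diff has_derivative_const) simp
  from has_derivative_transform_within_open[OF this S J'[symmetric]]
  show ?thesis by simp
qed

text \<open>The derivative of \<open>J\<close> is built from \<open>J\<close> itself and the
  derivative of \<open>\<Omega>\<close>, so each order of differentiability of \<open>J\<close>
  gives the next.\<close>

lemma smooth_on_blinfun_inverse:
  assumes S: "open S"
    and inv: "\<And>y. y \<in> S \<Longrightarrow> J y o\<^sub>L \<Omega> y = id_blinfun" "\<And>y. y \<in> S \<Longrightarrow> \<Omega> y o\<^sub>L J y = id_blinfun"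
    and \<Omega>: "smooth_on S \<Omega>"
  shows "smooth_on S J"
  unfolding smooth_on_def
proof
  note d = blinfun_inverse_has_derivative[OF S _ inv smooth_onE(1)[OF \<Omega>]]
  show "Ck_on k S J" for k
  proof (induction k)
    case 0
    then show ?case
      using d by (auto intro!: continuous_at_imp_continuous_on has_derivative_continuous)
  next
    case (Suc k)
    have "Ck_on k S (\<lambda>x. frechet_derivative \<Omega> (at x) v)" for v
      using smooth_onE(2)[OF \<Omega>] by (simp add: smooth_on_def)
    then show ?case
      by (intro Ck_on_SucI[OF S d] Ck_on_bounded_linear[OF S _ bounded_linear_minus[OF bounded_linear_ident]]
          Ck_on_bilinear[OF bounded_bilinear_blinfun_compose S] Suc) auto
  qed
qed

text \<open>
  The second difference quotient is symmetric in \<open>u\<close> and \<open>v\<close>; the mean value theorem in direction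
  \<open>u\<close> shows that it converges to the iterated derivative.
\<close>

lemma second_difference_estimate:
  fixes F :: "'e::real_normed_vector \<Rightarrow> real"
  assumes S: "open S" "x \<in> S" and F: "\<And>y. y \<in> S \<Longrightarrow> (F has_derivative F' y) (at y)"
    and p: "((\<lambda>y. F' y u) has_derivative D) (at x)" and e: "e > 0"
  obtains \<delta> where "\<delta> > 0"
    "\<And>h. 0 < h \<Longrightarrow> h < \<delta> \<Longrightarrow>
      \<bar>F (x + h *\<^sub>R u + h *\<^sub>R v) - F (x + h *\<^sub>R u) - F (x + h *\<^sub>R v) + F x - h\<^sup>2 * D v\<bar> \<le> e * h\<^sup>2"
proof -
  \<comment> \<open>Displacements \<open>s *\<^sub>R u + t *\<^sub>R v\<close> with \<open>s\<close>
    and \<open>t\<close> in \<open>[0, h]\<close> have norm at most \<open>h * M\<close>; the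
    summand 1 keeps \<open>M\<close> positive when \<open>u\<close> and \<open>v\<close> vanish. The
    2 in \<open>e'\<close> pays for subtracting two first-order estimates.\<close>
  define M where "M = norm u + norm v + 1"
  have M: "M > 0" by (simp add: M_def add_nonneg_pos)
  define e' where "e' = e / (2 * M)"
  have e': "e' > 0" using e M by (simp add: e'_def)
  obtain r where r: "r > 0" "ball x r \<subseteq> S" using S openE by blast
  obtain d where d: "d > 0" "\<And>y. norm (y - x) < d \<Longrightarrow> \<bar>F' y u - F' x u - D (y - x)\<bar> \<le> e' * norm (y - x)"
    using p e' unfolding has_derivative_at_alt by (auto simp: real_norm_def)
  have D: "linear D" using p by (rule has_derivative_linear)
  show thesis
  proof (rule that)
    show "min d r / M > 0" using d r M by simp
    fix h :: real assume h: "0 < h" "h < min d r / M"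
    then have hM: "h * M < d" "h * M < r" using M by (simp_all add: field_simps)
    have small: "norm (s *\<^sub>R u + t *\<^sub>R v) \<le> h * M" if "0 \<le> s" "s \<le> h" "0 \<le> t" "t \<le> h" for s t
    proof -
      have "norm (s *\<^sub>R u + t *\<^sub>R v) \<le> s * norm u + t * norm v"
        using norm_triangle_ineq[of "s *\<^sub>R u" "t *\<^sub>R v"] that by simp
      also have "\<dots> \<le> h * norm u + h * norm v" using that by (intro add_mono mult_right_mono) auto
      also have "\<dots> \<le> h * M" using h(1) by (simp add: M_def algebra_simps)
      finally show ?thesis .
    qed
    have inS: "x + (s *\<^sub>R u + t *\<^sub>R v) \<in> S" if "0 \<le> s" "s \<le> h" "0 \<le> t" "t \<le> h" for s t
    proof (rule subsetD[OF r(2)])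
      have "dist x (x + w) = norm w" for w by (simp add: dist_norm)
      then show "x + (s *\<^sub>R u + t *\<^sub>R v) \<in> ball x r" using small[OF that] hM(2) by (simp only: mem_ball)
    qed
    have est: "\<bar>F' (x + (s *\<^sub>R u + t *\<^sub>R v)) u - F' x u - D (s *\<^sub>R u + t *\<^sub>R v)\<bar> \<le> e' * (h * M)"
      if "0 \<le> s" "s \<le> h" "0 \<le> t" "t \<le> h" for s t
    proof -
      have "\<bar>F' (x + (s *\<^sub>R u + t *\<^sub>R v)) u - F' x u - D (s *\<^sub>R u + t *\<^sub>R v)\<bar>
          \<le> e' * norm (s *\<^sub>R u + t *\<^sub>R v)"
        using d(2)[of "x + (s *\<^sub>R u + t *\<^sub>R v)"] small[OF that] hM(1) by simp
      then show ?thesis using small[OF that] e' by (meson mult_left_mono order_trans less_imp_le)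
    qed
    have der: "((\<lambda>s. F (x + (s *\<^sub>R u + t *\<^sub>R v))) has_real_derivative F' (x + (s *\<^sub>R u + t *\<^sub>R v)) u) (at s)"
      if "0 \<le> s" "s \<le> h" "0 \<le> t" "t \<le> h" for s t
    proof -
      have "((\<lambda>s. x + (s *\<^sub>R u + t *\<^sub>R v)) has_derivative (\<lambda>k. k *\<^sub>R u)) (at s)"
        by (auto intro!: derivative_eq_intros)
      from diff_chain_at[OF this F[OF inS[OF that]]]
      show ?thesis
        using has_derivative_linear[OF F[OF inS[OF that]]]
        by (simp add: has_field_derivative_def o_def linear_scale mult.commute[of _ "F' _ u"] mult_commute_abs)
    qed
    \<comment> \<open>\<open>\<phi> h - \<phi> 0\<close> is the second difference. The term
      \<open>0 *\<^sub>R v\<close> keeps both summands in the shape of \<open>der\<close> and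
      \<open>est\<close>.\<close>
    define \<phi> where "\<phi> s = F (x + (s *\<^sub>R u + h *\<^sub>R v)) - F (x + (s *\<^sub>R u + 0 *\<^sub>R v))" for s
    have "\<exists>z. 0 < z \<and> z < h \<and> \<phi> h - \<phi> 0
        = (h - 0) * (F' (x + (z *\<^sub>R u + h *\<^sub>R v)) u - F' (x + (z *\<^sub>R u + 0 *\<^sub>R v)) u)"
      unfolding \<phi>_def using h(1) by (intro MVT2 DERIV_diff der) auto
    then obtain z where z: "0 < z" "z < h" "\<phi> h - \<phi> 0
        = h * (F' (x + (z *\<^sub>R u + h *\<^sub>R v)) u - F' (x + (z *\<^sub>R u + 0 *\<^sub>R v)) u)" by auto
    have "\<bar>F' (x + (z *\<^sub>R u + h *\<^sub>R v)) u - F' (x + (z *\<^sub>R u + 0 *\<^sub>R v)) u - h * D v\<bar> \<le> e * h"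
    proof -
      have "D (z *\<^sub>R u + h *\<^sub>R v) - D (z *\<^sub>R u + 0 *\<^sub>R v) = h * D v"
        using D by (simp add: linear_add linear_scale)
      moreover have "2 * (e' * (h * M)) = e * h" using M by (simp add: e'_def)
      ultimately show ?thesis using est[of z h] est[of z 0] z h(1) by linarith
    qed
    then have "h * \<bar>F' (x + (z *\<^sub>R u + h *\<^sub>R v)) u - F' (x + (z *\<^sub>R u + 0 *\<^sub>R v)) u - h * D v\<bar> \<le> h * (e * h)"
      using h(1) by (intro mult_left_mono) auto
    then have "\<bar>\<phi> h - \<phi> 0 - h\<^sup>2 * D v\<bar> \<le> e * h\<^sup>2"
      using h(1) unfolding z(3) power2_eq_square
      by (simp add: abs_mult[of h, simplified abs_of_pos[OF h(1)], symmetric] algebra_simps)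
    then show "\<bar>F (x + h *\<^sub>R u + h *\<^sub>R v) - F (x + h *\<^sub>R u) - F (x + h *\<^sub>R v) + F x - h\<^sup>2 * D v\<bar> \<le> e * h\<^sup>2"
      by (simp add: \<phi>_def algebra_simps)
  qed
qed

lemma symmetric_second_derivative_real:
  fixes F :: "'e::real_normed_vector \<Rightarrow> real"
  assumes S: "open S" "x \<in> S" and F: "\<And>y. y \<in> S \<Longrightarrow> (F has_derivative F' y) (at y)"
    and u: "((\<lambda>y. F' y u) has_derivative Du) (at x)"
    and v: "((\<lambda>y. F' y v) has_derivative Dv) (at x)"
  shows "Du v = Dv u"
proof (rule ccontr)
  assume "Du v \<noteq> Dv u"
  \<comment> \<open>The two estimates of the same second difference bound the gap by
    \<open>2 * e\<close>, while it equals \<open>3 * e\<close> by this choice.\<close>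
  define e where "e = \<bar>Du v - Dv u\<bar> / 3"
  have e: "e > 0" using \<open>Du v \<noteq> Dv u\<close> by (simp add: e_def)
  obtain d1 where d1: "d1 > 0" "\<And>h. 0 < h \<Longrightarrow> h < d1 \<Longrightarrow>
      \<bar>F (x + h *\<^sub>R u + h *\<^sub>R v) - F (x + h *\<^sub>R u) - F (x + h *\<^sub>R v) + F x - h\<^sup>2 * Du v\<bar> \<le> e * h\<^sup>2"
    using second_difference_estimate[OF S F u e] by blast
  obtain d2 where d2: "d2 > 0" "\<And>h. 0 < h \<Longrightarrow> h < d2 \<Longrightarrow>
      \<bar>F (x + h *\<^sub>R v + h *\<^sub>R u) - F (x + h *\<^sub>R v) - F (x + h *\<^sub>R u) + F x - h\<^sup>2 * Dv u\<bar> \<le> e * h\<^sup>2"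
    using second_difference_estimate[OF S F v e] by blast
  define h where "h = min d1 d2 / 2"
  have h: "0 < h" "h < d1" "h < d2" using d1(1) d2(1) by (auto simp: h_def)
  have "x + h *\<^sub>R v + h *\<^sub>R u = x + h *\<^sub>R u + h *\<^sub>R v" by (simp add: algebra_simps)
  then have "\<bar>h\<^sup>2 * Du v - h\<^sup>2 * Dv u\<bar> \<le> 2 * (e * h\<^sup>2)"
    using d1(2)[OF h(1,2)] d2(2)[OF h(1,3)] by (simp only: abs_le_iff) linarith
  moreover have "h\<^sup>2 * \<bar>Du v - Dv u\<bar> = \<bar>h\<^sup>2 * Du v - h\<^sup>2 * Dv u\<bar>"
    by (simp add: abs_mult flip: right_diff_distrib)
  ultimately have "h\<^sup>2 * \<bar>Du v - Dv u\<bar> \<le> h\<^sup>2 * (2 * e)" by (simp add: algebra_simps)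
  then have "\<bar>Du v - Dv u\<bar> \<le> 2 * e" using h(1) by (simp add: mult_le_cancel_left)
  then show False using e by (simp add: e_def)
qed

text \<open>Taking inner products with an arbitrary \<open>z\<close> reduces the vector-valued case
  to the real one.\<close>

lemma symmetric_second_derivative:
  fixes f :: "'e::real_normed_vector \<Rightarrow> 'f::real_inner"
  assumes S: "open S" "x \<in> S" and f: "smooth_on S f"
  shows "frechet_derivative (\<lambda>y. frechet_derivative f (at y) u) (at x) v
       = frechet_derivative (\<lambda>y. frechet_derivative f (at y) v) (at x) u"
proof -
  note d = bounded_linear.has_derivative[OF bounded_linear_inner_left]
  note f1 = smooth_onE(1)[OF f] and f2 = smooth_onE(1)[OF smooth_onE(2)[OF f] S(2)]
  have "frechet_derivative (\<lambda>y. frechet_derivative f (at y) u) (at x) v \<bullet> z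
      = frechet_derivative (\<lambda>y. frechet_derivative f (at y) v) (at x) u \<bullet> z" for z
    by (rule symmetric_second_derivative_real[OF S d[OF f1] d[OF f2] d[OF f2]])
  then show ?thesis by (metis vector_eq_rdot)
qed

text \<open>The direction is expanded in \<open>B\<close>, and the product rule is applied to the
  summands. The terms that differentiate \<open>f\<close> twice reassemble into a second derivative
  with the direction frozen at \<open>g x\<close>.\<close>

lemma derivative_apply_has_derivative:
  fixes f :: "'e::real_inner \<Rightarrow> 'v::real_normed_vector"
  assumes "finite_dim TYPE('e)" and S: "open S" "x \<in> S" and f: "smooth_on S f"
    and g: "(g has_derivative g') (at x)"
  shows "((\<lambda>y. frechet_derivative f (at y) (g y)) has_derivative
    (\<lambda>v. frechet_derivative f (at x) (g' v)
       + frechet_derivative (\<lambda>y. frechet_derivative f (at y) (g x)) (at x) v)) (at x)"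
proof -
  obtain B :: "'e set" where B: "finite B" "\<And>x. (\<Sum>b\<in>B. (x \<bullet> b) *\<^sub>R b) = x"
    using finite_dim_orthonormal_basis[OF assms(1)] by blast
  let ?D = "\<lambda>y. frechet_derivative f (at y)"
  have eq: "(\<Sum>b\<in>B. (w \<bullet> b) *\<^sub>R ?D y b) = ?D y w" if "y \<in> S" for y w
    using smooth_onE(1)[OF f that] by (intro linear_orthonormal_expansion[OF _ B(2)] has_derivative_linear)
  have D2: "((\<lambda>y. ?D y b) has_derivative frechet_derivative (\<lambda>y. ?D y b) (at x)) (at x)" for b
    by (rule smooth_onE(1)[OF smooth_onE(2)[OF f] S(2)])
  have inner_g: "((\<lambda>y. g y \<bullet> b) has_derivative (\<lambda>v. g' v \<bullet> b)) (at x)" for b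
    by (rule bounded_linear.has_derivative[OF bounded_linear_inner_left g])
  have "((\<lambda>y. \<Sum>b\<in>B. (g x \<bullet> b) *\<^sub>R ?D y b) has_derivative
     (\<lambda>v. \<Sum>b\<in>B. (g x \<bullet> b) *\<^sub>R frechet_derivative (\<lambda>y. ?D y b) (at x) v)) (at x)"
    by (intro has_derivative_sum has_derivative_scaleR_right D2)
  from has_derivative_transform_within_open[OF this S eq]
  have D2_g: "frechet_derivative (\<lambda>y. ?D y (g x)) (at x)
      = (\<lambda>v. \<Sum>b\<in>B. (g x \<bullet> b) *\<^sub>R frechet_derivative (\<lambda>y. ?D y b) (at x) v)"
    by (rule frechet_derivative_eqI)
  have "((\<lambda>y. \<Sum>b\<in>B. (g y \<bullet> b) *\<^sub>R ?D y b) has_derivative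
     (\<lambda>v. \<Sum>b\<in>B. (g x \<bullet> b) *\<^sub>R frechet_derivative (\<lambda>y. ?D y b) (at x) v + (g' v \<bullet> b) *\<^sub>R ?D x b)) (at x)"
    by (intro has_derivative_sum has_derivative_scaleR inner_g D2)
  from has_derivative_transform_within_open[OF this S eq]
  show ?thesis
    unfolding D2_g by (simp add: sum.distrib eq[OF S(2)] add.commute)
qed

section \<open>Change of charts\<close>

locale smooth_mfd =
  fixes \<A> :: "('m::{t2_space,second_countable_topology}, 'e::real_inner) atlas"
  assumes smooth_manifold: "smooth_manifold \<A>"
begin

lemma finite_dim: "finite_dim TYPE('e)"
  using smooth_manifold by (simp add: smooth_manifold_def)

lemma chart_at: "chart_at \<A> p \<in> \<A>" "p \<in> fst (chart_at \<A> p)"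
proof -
  have "p \<in> (\<Union>c\<in>\<A>. fst c)" using smooth_manifold by (simp add: smooth_manifold_def)
  then have "\<exists>c. c \<in> \<A> \<and> p \<in> fst c" by blast
  then have "chart_at \<A> p \<in> \<A> \<and> p \<in> fst (chart_at \<A> p)"
    unfolding chart_at_def by (rule someI_ex)
  then show "chart_at \<A> p \<in> \<A>" "p \<in> fst (chart_at \<A> p)" by auto
qed

lemma is_chart: "c \<in> \<A> \<Longrightarrow> is_chart c"
  using smooth_manifold by (simp add: smooth_manifold_def)

lemma chart_inv [simp]: "c \<in> \<A> \<Longrightarrow> p \<in> fst c \<Longrightarrow> chart_inv c (snd c p) = p"
  using is_chart by (auto simp: is_chart_def homeomorphism_def)

lemma chart_image_open: "c \<in> \<A> \<Longrightarrow> open W \<Longrightarrow> open (snd c ` (fst c \<inter> W))"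
proof -
  assume c: "c \<in> \<A>" "open W"
  have "snd c ` (fst c \<inter> W) = chart_image c \<inter> chart_inv c -` W"
    using c(1) by (force simp: chart_image_def)
  moreover have "continuous_on (chart_image c) (chart_inv c)" "open (chart_image c)"
    using is_chart[OF c(1)] by (auto simp: is_chart_def homeomorphism_def)
  ultimately show ?thesis using c(2) by (simp add: continuous_open_preimage)
qed

lemma chart_open: "c \<in> \<A> \<Longrightarrow> open (fst c)"
  using is_chart by (simp add: is_chart_def)

lemma transition_smooth:
  "c \<in> \<A> \<Longrightarrow> d \<in> \<A> \<Longrightarrow> smooth_on (snd c ` (fst c \<inter> fst d)) (snd d \<circ> chart_inv c)"
  using smooth_manifold by (auto simp: smooth_manifold_def)

lemma coord_change_has_derivative:
  assumes "c \<in> \<A>" "d \<in> \<A>" "p \<in> fst c" "p \<in> fst d"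
  shows "((snd d \<circ> chart_inv c) has_derivative coord_change c d p) (at (snd c p))"
  unfolding coord_change_def
  by (rule smooth_onE(1)[OF transition_smooth]) (use assms in auto)

lemma bounded_linear_coord_change:
  "c \<in> \<A> \<Longrightarrow> d \<in> \<A> \<Longrightarrow> p \<in> fst c \<Longrightarrow> p \<in> fst d \<Longrightarrow> bounded_linear (coord_change c d p)"
  using coord_change_has_derivative has_derivative_bounded_linear by blast

text \<open>Identities between coordinate expressions hold only where the chart domains overlap. The
  image of such an overlap is open, which suffices for derivatives.\<close>

lemma has_derivative_in_chart:
  assumes c: "c \<in> \<A>" "p \<in> fst c" and W: "open W" "p \<in> W"
    and f: "(f has_derivative f') (at (snd c p))"
    and eq: "\<And>q. q \<in> fst c \<Longrightarrow> q \<in> W \<Longrightarrow> f (snd c q) = g (snd c q)"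
  shows "(g has_derivative f') (at (snd c p))"
  by (rule has_derivative_transform_within_open[OF f chart_image_open[OF c(1) W(1)]])
     (use c W eq in auto)

lemma coord_change_compose:
  assumes "c \<in> \<A>" "d \<in> \<A>" "e \<in> \<A>" "p \<in> fst c" "p \<in> fst d" "p \<in> fst e"
  shows "coord_change d e p (coord_change c d p v) = coord_change c e p v"
proof -
  have "((snd e \<circ> chart_inv d) has_derivative coord_change d e p) (at ((snd d \<circ> chart_inv c) (snd c p)))"
    using coord_change_has_derivative[of d e p] assms by simp
  note chain = diff_chain_at[OF coord_change_has_derivative[OF assms(1,2,4,5)] this]
  have "((snd e \<circ> chart_inv c) has_derivative coord_change d e p \<circ> coord_change c d p) (at (snd c p))"
    by (rule has_derivative_in_chart[OF assms(1,4) chart_open[OF assms(2)] assms(5) chain])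
       (use assms in simp)
  from has_derivative_unique[OF this coord_change_has_derivative[of c e p]] assms
  show ?thesis by (simp add: fun_eq_iff)
qed

lemma coord_change_refl: "c \<in> \<A> \<Longrightarrow> p \<in> fst c \<Longrightarrow> coord_change c c p v = v"
proof -
  assume c: "c \<in> \<A>" "p \<in> fst c"
  have "((snd c \<circ> chart_inv c) has_derivative (\<lambda>v. v)) (at (snd c p))"
    by (rule has_derivative_in_chart[OF c chart_open[OF c(1)] c(2) has_derivative_ident])
       (use c in auto)
  from has_derivative_unique[OF this coord_change_has_derivative[of c c p]] c
  show ?thesis by (simp add: fun_eq_iff)
qed

section \<open>Coordinate representatives of fields and forms\<close>

lemma vf_rep_apply:
  "c \<in> \<A> \<Longrightarrow> p \<in> fst c \<Longrightarrow> vf_rep \<A> c X (snd c p) = coord_change (chart_at \<A> p) c p (X p)"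
  by (simp add: vf_rep_def)

lemma form_rep_apply:
  "c \<in> \<A> \<Longrightarrow> p \<in> fst c \<Longrightarrow>
    form_rep \<A> c \<alpha> (snd c p) v = \<alpha> p (coord_change c (chart_at \<A> p) p v)"
  by (simp add: form_rep_def bounded_linear_Blinfun_apply bounded_linear_coord_change chart_at)

lemma vf_rep_chart_at: "vf_rep \<A> (chart_at \<A> p) X (snd (chart_at \<A> p) p) = X p"
  by (simp add: vf_rep_apply chart_at coord_change_refl)

lemma form_rep_chart_at: "form_rep \<A> (chart_at \<A> p) \<alpha> (snd (chart_at \<A> p) p) = \<alpha> p"
  by (rule blinfun_eqI) (simp add: form_rep_apply chart_at coord_change_refl)

lemma form_rep_vf_rep:
  "c \<in> \<A> \<Longrightarrow> p \<in> fst c \<Longrightarrow> form_rep \<A> c \<alpha> (snd c p) (vf_rep \<A> c X (snd c p)) = \<alpha> p (X p)"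
  by (simp add: vf_rep_apply form_rep_apply coord_change_compose coord_change_refl chart_at)

lemma vf_rep_change:
  assumes "c \<in> \<A>" "d \<in> \<A>" "p \<in> fst c" "p \<in> fst d"
  shows "vf_rep \<A> d X (snd d p) = coord_change c d p (vf_rep \<A> c X (snd c p))"
  using assms by (simp add: vf_rep_apply coord_change_compose chart_at)

lemma form_rep_change:
  assumes "c \<in> \<A>" "d \<in> \<A>" "p \<in> fst c" "p \<in> fst d"
  shows "form_rep \<A> d \<alpha> (snd d p) (coord_change c d p v) = form_rep \<A> c \<alpha> (snd c p) v"
  using assms by (simp add: form_rep_apply coord_change_compose chart_at)

lemma vf_rep_smooth:
  "smooth_vector_field \<A> UNIV X \<Longrightarrow> c \<in> \<A> \<Longrightarrow> smooth_on (chart_image c) (vf_rep \<A> c X)"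
  by (simp add: smooth_vector_field_def chart_image_def)

lemma form_rep_smooth:
  "smooth_form \<A> UNIV \<alpha> \<Longrightarrow> c \<in> \<A> \<Longrightarrow> smooth_on (chart_image c) (form_rep \<A> c \<alpha>)"
  by (simp add: smooth_form_def chart_image_def)

lemma vf_rep_has_derivative:
  assumes "smooth_vector_field \<A> UNIV X" "c \<in> \<A>" "p \<in> fst c"
  shows "(vf_rep \<A> c X has_derivative frechet_derivative (vf_rep \<A> c X) (at (snd c p))) (at (snd c p))"
  by (rule smooth_onE(1)[OF vf_rep_smooth]) (use assms in \<open>auto simp: chart_image_def\<close>)

lemma form_rep_has_derivative:
  assumes "smooth_form \<A> UNIV \<alpha>" "c \<in> \<A>" "p \<in> fst c"
  shows "(form_rep \<A> c \<alpha> has_derivative frechet_derivative (form_rep \<A> c \<alpha>) (at (snd c p))) (at (snd c p))"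
  by (rule smooth_onE(1)[OF form_rep_smooth]) (use assms in \<open>auto simp: chart_image_def\<close>)

text \<open>The Hessian of the transition map, with \<open>u\<close> the direction of the inner
  derivative. It is the inhomogeneous term in the transformation of first derivatives of fields and
  forms.\<close>

definition coord_change2 ::
  "('m, 'e) chart \<Rightarrow> ('m, 'e) chart \<Rightarrow> 'm \<Rightarrow> 'e \<Rightarrow> 'e \<Rightarrow> 'e" where
  "coord_change2 c d p u v = frechet_derivative
     (\<lambda>y. frechet_derivative (snd d \<circ> chart_inv c) (at y) u) (at (snd c p)) v"

lemma coord_change2_commute:
  assumes "c \<in> \<A>" "d \<in> \<A>" "p \<in> fst c" "p \<in> fst d"
  shows "coord_change2 c d p u v = coord_change2 c d p v u"
  unfolding coord_change2_def
  by (rule symmetric_second_derivative[OF chart_image_open[OF assms(1) chart_open[OF assms(2)]]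
        _ transition_smooth]) (use assms in auto)

lemma coord_change_apply_has_derivative:
  assumes "c \<in> \<A>" "d \<in> \<A>" "p \<in> fst c" "p \<in> fst d" and g: "(g has_derivative g') (at (snd c p))"
  shows "((\<lambda>y. frechet_derivative (snd d \<circ> chart_inv c) (at y) (g y)) has_derivative
    (\<lambda>v. coord_change c d p (g' v) + coord_change2 c d p (g (snd c p)) v)) (at (snd c p))"
  unfolding coord_change_def coord_change2_def
  by (rule derivative_apply_has_derivative[OF finite_dim
        chart_image_open[OF assms(1) chart_open[OF assms(2)]] _ transition_smooth g])
     (use assms in auto)

lemma compose_transition_has_derivative:
  assumes "c \<in> \<A>" "d \<in> \<A>" "p \<in> fst c" "p \<in> fst d" "(f has_derivative f') (at (snd d p))"
  shows "((\<lambda>y. f ((snd d \<circ> chart_inv c) y)) has_derivative (\<lambda>v. f' (coord_change c d p v))) (at (snd c p))"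
  using diff_chain_at[OF coord_change_has_derivative[OF assms(1-4)], of f f'] assms
  by (simp add: o_def)

text \<open>Differentiates both sides of \<open>vf_rep_change\<close> along \<open>c\<close>: the
  chain rule on the left, and on the right the product rule for the Jacobian applied to the field,
  which brings in the Hessian.\<close>

lemma vf_rep_derivative_change:
  assumes X: "smooth_vector_field \<A> UNIV X"
    and cd: "c \<in> \<A>" "d \<in> \<A>" "p \<in> fst c" "p \<in> fst d"
  shows "frechet_derivative (vf_rep \<A> d X) (at (snd d p)) (coord_change c d p v)
    = coord_change c d p (frechet_derivative (vf_rep \<A> c X) (at (snd c p)) v)
      + coord_change2 c d p (vf_rep \<A> c X (snd c p)) v"
proof -
  note 1 = coord_change_apply_has_derivative[OF cd vf_rep_has_derivative[OF X cd(1,3)]]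
  note 2 = compose_transition_has_derivative[OF cd vf_rep_has_derivative[OF X cd(2,4)]]
  have "((\<lambda>y. vf_rep \<A> d X ((snd d \<circ> chart_inv c) y)) has_derivative
    (\<lambda>v. coord_change c d p (frechet_derivative (vf_rep \<A> c X) (at (snd c p)) v)
      + coord_change2 c d p (vf_rep \<A> c X (snd c p)) v)) (at (snd c p))"
    by (rule has_derivative_in_chart[OF cd(1,3) chart_open[OF cd(2)] cd(4) 1])
       (use cd in \<open>simp add: vf_rep_change[of c d] coord_change_def[symmetric]\<close>)
  from has_derivative_unique[OF 2 this] show ?thesis by (simp add: fun_eq_iff)
qed

text \<open>Differentiates \<open>form_rep_change\<close> with \<open>w\<close> fixed in the chart
  \<open>c\<close>; the Hessian arises because the image of \<open>w\<close> in \<open>d\<close>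
  varies with the point.\<close>

lemma form_rep_derivative_change:
  assumes \<alpha>: "smooth_form \<A> UNIV \<alpha>"
    and cd: "c \<in> \<A>" "d \<in> \<A>" "p \<in> fst c" "p \<in> fst d"
  shows "frechet_derivative (form_rep \<A> c \<alpha>) (at (snd c p)) v w
    = frechet_derivative (form_rep \<A> d \<alpha>) (at (snd d p)) (coord_change c d p v) (coord_change c d p w)
      + form_rep \<A> d \<alpha> (snd d p) (coord_change2 c d p w v)"
proof -
  note 1 = bounded_linear.has_derivative[OF blinfun.bounded_linear_left form_rep_has_derivative[OF \<alpha> cd(1,3)], of w]
  note 2 = bounded_bilinear.FDERIV[OF bounded_bilinear_blinfun_apply
      compose_transition_has_derivative[OF cd form_rep_has_derivative[OF \<alpha> cd(2,4)]]
      coord_change_apply_has_derivative[OF cd has_derivative_const[of w]]]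
  have 3: "((\<lambda>y. form_rep \<A> d \<alpha> ((snd d \<circ> chart_inv c) y)
          (frechet_derivative (snd d \<circ> chart_inv c) (at y) w))
      has_derivative (\<lambda>v. frechet_derivative (form_rep \<A> c \<alpha>) (at (snd c p)) v w)) (at (snd c p))"
    by (rule has_derivative_in_chart[OF cd(1,3) chart_open[OF cd(2)] cd(4) 1])
       (use cd in \<open>simp add: form_rep_change[of c d] coord_change_def[symmetric]\<close>)
  have "coord_change c d p 0 = 0"
    using bounded_linear_coord_change[OF cd] by (simp add: linear_0 bounded_linear.linear)
  with has_derivative_unique[OF 3 2] cd show ?thesis
    by (simp add: fun_eq_iff coord_change_def[symmetric])
qed

text \<open>The two Hessian terms cancel by symmetry. What results is one formula valid on the whole
  domain of \<open>c\<close>, whereas the definition changes its chart with the point.\<close>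

lemma lie_bracket_rep:
  assumes X: "smooth_vector_field \<A> UNIV X" and Y: "smooth_vector_field \<A> UNIV Y"
    and c: "c \<in> \<A>" "p \<in> fst c"
  shows "vf_rep \<A> c (lie_bracket \<A> X Y) (snd c p)
    = frechet_derivative (vf_rep \<A> c Y) (at (snd c p)) (vf_rep \<A> c X (snd c p))
    - frechet_derivative (vf_rep \<A> c X) (at (snd c p)) (vf_rep \<A> c Y (snd c p))"
proof -
  note d = chart_at[of p]
  note cd = d(1) c(1) d(2) c(2)
  note lin = bounded_linear.linear[OF bounded_linear_coord_change[OF cd]]
  show ?thesis
    using coord_change2_commute[OF cd, of "X p" "Y p"]
    by (simp add: vf_rep_apply[OF c] lie_bracket_def Let_def linear_diff[OF lin]
        vf_rep_derivative_change[OF X cd] vf_rep_derivative_change[OF Y cd] vf_rep_chart_at)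
qed

lemma d_form_rep:
  assumes \<alpha>: "smooth_form \<A> UNIV \<alpha>" and c: "c \<in> \<A>" "p \<in> fst c"
  shows "d_form \<A> \<alpha> p (coord_change c (chart_at \<A> p) p v) (coord_change c (chart_at \<A> p) p w)
    = frechet_derivative (form_rep \<A> c \<alpha>) (at (snd c p)) v w
    - frechet_derivative (form_rep \<A> c \<alpha>) (at (snd c p)) w v"
proof -
  note d = chart_at[of p]
  note cd = c(1) d(1) c(2) d(2)
  show ?thesis
    using coord_change2_commute[OF cd, of v w]
    by (simp add: d_form_def Let_def form_rep_derivative_change[OF \<alpha> cd])
qed

text \<open>Guarantees that the \<open>Blinfun\<close> in \<open>lie_derivative\<close> evaluates to
  the intended functional.\<close>

lemma bounded_linear_d_form:
  assumes \<alpha>: "smooth_form \<A> UNIV \<alpha>"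
  shows "bounded_linear (d_form \<A> \<alpha> p v)"
proof -
  have "bounded_linear (frechet_derivative (form_rep \<A> (chart_at \<A> p) \<alpha>) (at (snd (chart_at \<A> p) p)))"
    using form_rep_has_derivative[OF \<alpha> chart_at] by (rule has_derivative_bounded_linear)
  then have "bounded_linear (\<lambda>w. frechet_derivative (form_rep \<A> (chart_at \<A> p) \<alpha>) (at (snd (chart_at \<A> p) p)) w v)"
    by (rule bounded_linear_compose[OF blinfun.bounded_linear_left])
  then show ?thesis
    unfolding d_form_def Let_def by (intro bounded_linear_sub blinfun.bounded_linear_right)
qed

lemma d_fun_rep:
  assumes c: "c \<in> \<A>" "p \<in> fst c" and f: "(f \<circ> chart_inv c has_derivative f') (at (snd c p))"
  shows "d_fun \<A> f p (coord_change c (chart_at \<A> p) p v) = f' v"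
proof -
  note d = chart_at[of p]
  note cd = d(1) c(1) d(2) c(2)
  have "(f \<circ> chart_inv (chart_at \<A> p) has_derivative (\<lambda>v. f' (coord_change (chart_at \<A> p) c p v)))
      (at (snd (chart_at \<A> p) p))"
    by (rule has_derivative_in_chart[OF d chart_open[OF c(1)] c(2)
          compose_transition_has_derivative[OF cd f]]) (use cd in simp)
  then show ?thesis
    using cd by (simp add: d_fun_def Let_def frechet_derivative_eqI bounded_linear_Blinfun_apply
        has_derivative_bounded_linear coord_change_compose coord_change_refl)
qed

end

section \<open>The Courant bracket in coordinates\<close>

context smooth_mfd
begin

lemma contraction_has_derivative:
  assumes X: "smooth_vector_field \<A> UNIV X" and \<eta>: "smooth_form \<A> UNIV \<eta>"
    and c: "c \<in> \<A>" "p \<in> fst c"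
  shows "((\<lambda>q. \<eta> q (X q)) \<circ> chart_inv c has_derivative
    (\<lambda>v. form_rep \<A> c \<eta> (snd c p) (frechet_derivative (vf_rep \<A> c X) (at (snd c p)) v)
      + frechet_derivative (form_rep \<A> c \<eta>) (at (snd c p)) v (vf_rep \<A> c X (snd c p)))) (at (snd c p))"
  by (rule has_derivative_in_chart[OF c open_UNIV UNIV_I
        bounded_bilinear.FDERIV[OF bounded_bilinear_blinfun_apply
          form_rep_has_derivative[OF \<eta> c] vf_rep_has_derivative[OF X c]]])
     (use c in \<open>simp add: form_rep_vf_rep\<close>)

text \<open>In Cartan's formula the term differentiating \<open>\<eta>\<close> along
  \<open>v\<close> occurs in both summands with opposite signs and drops out.\<close>

lemma lie_derivative_rep:
  assumes X: "smooth_vector_field \<A> UNIV X" and \<eta>: "smooth_form \<A> UNIV \<eta>"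
    and c: "c \<in> \<A>" "p \<in> fst c"
  shows "form_rep \<A> c (lie_derivative \<A> X \<eta>) (snd c p) v
    = frechet_derivative (form_rep \<A> c \<eta>) (at (snd c p)) (vf_rep \<A> c X (snd c p)) v
    + form_rep \<A> c \<eta> (snd c p) (frechet_derivative (vf_rep \<A> c X) (at (snd c p)) v)"
proof -
  have "X p = coord_change c (chart_at \<A> p) p (vf_rep \<A> c X (snd c p))"
    using c by (simp add: vf_rep_apply coord_change_compose coord_change_refl chart_at)
  then show ?thesis
    using d_form_rep[OF \<eta> c, of "vf_rep \<A> c X (snd c p)" v]
    by (simp add: form_rep_apply[OF c] lie_derivative_def blinfun.add_left
        bounded_linear_Blinfun_apply bounded_linear_d_form[OF \<eta>]
        d_fun_rep[OF c contraction_has_derivative[OF X \<eta> c]])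
qed

text \<open>The exact term of the bracket removes half of what the Lie derivatives contribute
  through derivatives of \<open>X\<close> and \<open>Y\<close>, and adds half of the derivatives of
  \<open>\<eta>\<close> and \<open>\<xi>\<close> along \<open>v\<close>.\<close>

lemma courant_bracket_rep:
  assumes s: "smooth_section \<A> UNIV s" and t: "smooth_section \<A> UNIV t"
    and c: "c \<in> \<A>" "p \<in> fst c"
  defines "x \<equiv> snd c p"
    and "X \<equiv> vf_rep \<A> c (\<lambda>q. fst (s q))" and "\<xi> \<equiv> form_rep \<A> c (\<lambda>q. snd (s q))"
    and "Y \<equiv> vf_rep \<A> c (\<lambda>q. fst (t q))" and "\<eta> \<equiv> form_rep \<A> c (\<lambda>q. snd (t q))"
  shows "vf_rep \<A> c (\<lambda>q. fst (courant_bracket \<A> s t q)) x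
      = frechet_derivative Y (at x) (X x) - frechet_derivative X (at x) (Y x)"
    and "form_rep \<A> c (\<lambda>q. snd (courant_bracket \<A> s t q)) x v
      = frechet_derivative \<eta> (at x) (X x) v - frechet_derivative \<xi> (at x) (Y x) v
        + (1/2) * (\<eta> x (frechet_derivative X (at x) v) - frechet_derivative \<eta> (at x) v (X x)
                 - \<xi> x (frechet_derivative Y (at x) v) + frechet_derivative \<xi> (at x) v (Y x))"
proof -
  have X: "smooth_vector_field \<A> UNIV (\<lambda>q. fst (s q))" and \<xi>: "smooth_form \<A> UNIV (\<lambda>q. snd (s q))"
    and Y: "smooth_vector_field \<A> UNIV (\<lambda>q. fst (t q))" and \<eta>: "smooth_form \<A> UNIV (\<lambda>q. snd (t q))"
    using s t by (auto simp: smooth_section_def)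
  show "vf_rep \<A> c (\<lambda>q. fst (courant_bracket \<A> s t q)) x
      = frechet_derivative Y (at x) (X x) - frechet_derivative X (at x) (Y x)"
    using lie_bracket_rep[OF X Y c] by (simp add: courant_bracket_def Let_def x_def X_def Y_def)
  have "((\<lambda>q. snd (t q) (fst (s q)) - snd (s q) (fst (t q))) \<circ> chart_inv c has_derivative
     (\<lambda>v. (\<eta> x (frechet_derivative X (at x) v) + frechet_derivative \<eta> (at x) v (X x))
      - (\<xi> x (frechet_derivative Y (at x) v) + frechet_derivative \<xi> (at x) v (Y x)))) (at (snd c p))"
    using has_derivative_diff[OF contraction_has_derivative[OF X \<eta> c] contraction_has_derivative[OF Y \<xi> c]]
    by (simp add: o_def x_def X_def Y_def \<xi>_def \<eta>_def)
  note df = d_fun_rep[OF c this]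
  have "form_rep \<A> c (\<lambda>q. snd (courant_bracket \<A> s t q)) x v
      = form_rep \<A> c (lie_derivative \<A> (\<lambda>q. fst (s q)) (\<lambda>q. snd (t q))) x v
      - form_rep \<A> c (lie_derivative \<A> (\<lambda>q. fst (t q)) (\<lambda>q. snd (s q))) x v
      - (1/2) * d_fun \<A> (\<lambda>q. snd (t q) (fst (s q)) - snd (s q) (fst (t q))) p
          (coord_change c (chart_at \<A> p) p v)"
    by (simp add: x_def form_rep_apply[OF c] courant_bracket_def Let_def blinfun.bilinear_simps)
  then show "form_rep \<A> c (\<lambda>q. snd (courant_bracket \<A> s t q)) x v
      = frechet_derivative \<eta> (at x) (X x) v - frechet_derivative \<xi> (at x) (Y x) v
        + (1/2) * (\<eta> x (frechet_derivative X (at x) v) - frechet_derivative \<eta> (at x) v (X x)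
                 - \<xi> x (frechet_derivative Y (at x) v) + frechet_derivative \<xi> (at x) v (Y x))"
    unfolding df x_def lie_derivative_rep[OF X \<eta> c] lie_derivative_rep[OF Y \<xi> c]
    unfolding x_def[symmetric] X_def[symmetric] Y_def[symmetric] \<xi>_def[symmetric] \<eta>_def[symmetric]
    by (simp add: field_simps)
qed

text \<open>In a fixed chart the bracket is assembled from directional derivatives and evaluations
  of smooth representatives. The form component is tested on a fixed vector, and the nested rules
  follow its formula term by term.\<close>

lemma smooth_section_courant_bracket:
  assumes s: "smooth_section \<A> UNIV s" and t: "smooth_section \<A> UNIV t"
  shows "smooth_section \<A> UNIV (courant_bracket \<A> s t)"
proof -
  have X: "smooth_vector_field \<A> UNIV (\<lambda>q. fst (s q))" and \<xi>: "smooth_form \<A> UNIV (\<lambda>q. snd (s q))"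
    and Y: "smooth_vector_field \<A> UNIV (\<lambda>q. fst (t q))" and \<eta>: "smooth_form \<A> UNIV (\<lambda>q. snd (t q))"
    using s t by (auto simp: smooth_section_def)
  have "smooth_on (chart_image c) (vf_rep \<A> c (\<lambda>p. fst (courant_bracket \<A> s t p))) \<and>
      smooth_on (chart_image c) (form_rep \<A> c (\<lambda>p. snd (courant_bracket \<A> s t p)))"
    if c: "c \<in> \<A>" for c
  proof -
    have op: "open (chart_image c)" using is_chart[OF c] by (simp add: is_chart_def)
    note sm = vf_rep_smooth[OF X c] vf_rep_smooth[OF Y c] form_rep_smooth[OF \<xi> c] form_rep_smooth[OF \<eta> c]
    note D = smooth_on_derivative_apply[OF finite_dim op]
    note app = smooth_on_bilinear[OF bounded_bilinear_blinfun_apply op]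
    note ev = smooth_on_bounded_linear[OF op _ blinfun.bounded_linear_left]
    have "smooth_on (chart_image c) (vf_rep \<A> c (\<lambda>p. fst (courant_bracket \<A> s t p)))"
      by (rule smooth_on_cong[OF op _ smooth_on_diff[OF op D[OF sm(2,1)] D[OF sm(1,2)]]])
         (auto simp: chart_image_def courant_bracket_rep[OF s t c])
    moreover have "smooth_on (chart_image c) (form_rep \<A> c (\<lambda>p. snd (courant_bracket \<A> s t p)))"
      by (rule smooth_on_blinfunI[OF finite_dim op], rule smooth_on_cong[OF op _
          smooth_on_add[OF op
            smooth_on_diff[OF op ev[OF D[OF sm(4,1)]] ev[OF D[OF sm(3,2)]]]
            smooth_on_bounded_linear[OF op
              smooth_on_add[OF op
                smooth_on_diff[OF op
                  smooth_on_diff[OF op app[OF sm(4) smooth_onE(2)[OF sm(1)]]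
                    app[OF smooth_onE(2)[OF sm(4)] sm(1)]]
                  app[OF sm(3) smooth_onE(2)[OF sm(2)]]]
                app[OF smooth_onE(2)[OF sm(3)] sm(2)]]
              bounded_linear_mult_right[of "1/2"]]]])
         (auto simp: chart_image_def courant_bracket_rep[OF s t c])
    ultimately show ?thesis ..
  qed
  then show ?thesis
    by (simp add: smooth_section_def smooth_vector_field_def smooth_form_def chart_image_def)
qed

end

section \<open>The bracket of the Lie algebra\<close>

lemma chart_inv_prod:
  assumes "is_chart c" "x \<in> chart_image c" "y \<in> chart_image c"
  shows "chart_inv (fst c \<times> fst c, map_prod (snd c) (snd c)) (x, y) = (chart_inv c x, chart_inv c y)"
proof -
  have inj: "inj_on (snd c) (fst c)"
    using assms(1) by (auto simp: is_chart_def homeomorphism_def intro: inj_on_inverseI)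
  obtain p q where pq: "p \<in> fst c" "q \<in> fst c" "x = snd c p" "y = snd c q"
    using assms(2,3) by (auto simp: chart_image_def)
  have "inv_into (fst c \<times> fst c) (map_prod (snd c) (snd c)) (map_prod (snd c) (snd c) (p, q)) = (p, q)"
    by (rule inv_into_f_f) (use pq map_prod_inj_on[OF inj inj] in auto)
  then show ?thesis using pq inj by (simp add: chart_inv_def)
qed

text \<open>
  In the preferred chart at the unit, a left-invariant field is \<open>y \<mapsto> D\<mu>(y, 1)(0, A)\<close> for the local
  multiplication \<open>\<mu>\<close>. So it is differentiable and the bracket is linear in its second argument,
  without which \<open>coad\<close> would be a junk value.
\<close>

lemma lie_group_mult_in_chart:
  fixes \<A> :: "('g::{t2_space,second_countable_topology}, 'l::real_inner) atlas"
  assumes "lie_group \<A> G"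
  defines "c \<equiv> chart_at \<A> \<one>\<^bsub>G\<^esub>"
  obtains V where "open V" "\<one>\<^bsub>G\<^esub> \<in> V" "V \<subseteq> fst c" "\<And>g h. g \<in> V \<Longrightarrow> h \<in> V \<Longrightarrow> g \<otimes>\<^bsub>G\<^esub> h \<in> fst c"
    "smooth_on (snd c ` V \<times> snd c ` V) (\<lambda>z. snd c (chart_inv c (fst z) \<otimes>\<^bsub>G\<^esub> chart_inv c (snd z)))"
proof -
  interpret smooth_mfd \<A> using assms(1) by (simp add: smooth_mfd_def lie_group_def)
  interpret group G using assms(1) by (simp add: lie_group_def)
  have UN: "carrier G = UNIV" using assms(1) by (simp add: lie_group_def)
  have c: "c \<in> \<A>" "\<one>\<^bsub>G\<^esub> \<in> fst c" by (simp_all add: c_def chart_at)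
  let ?C = "(fst c \<times> fst c, map_prod (snd c) (snd c))"
  have "smooth_map (prod_atlas \<A> \<A>) \<A> UNIV (\<lambda>(g, h). g \<otimes>\<^bsub>G\<^esub> h)"
    using assms(1) by (simp add: lie_group_def)
  then obtain W m where W: "(\<one>\<^bsub>G\<^esub>, \<one>\<^bsub>G\<^esub>) \<in> W" "smooth_map_open (prod_atlas \<A> \<A>) \<A> W m"
    and m': "\<forall>q\<in>W \<inter> UNIV. m q = (\<lambda>(g, h). g \<otimes>\<^bsub>G\<^esub> h) q"
    unfolding smooth_map_def by blast
  have m: "m (g, h) = g \<otimes>\<^bsub>G\<^esub> h" if "(g, h) \<in> W" for g h using m' that by auto
  have "?C \<in> prod_atlas \<A> \<A>" using c(1) by (force simp: prod_atlas_def)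
  then have sm: "smooth_on (snd ?C ` (fst ?C \<inter> W \<inter> m -` fst c)) (snd c \<circ> m \<circ> chart_inv ?C)"
    using W(2) c(1) unfolding smooth_map_open_def by blast
  have "open (W \<inter> m -` fst c)"
    using W(2) chart_open[OF c(1)] by (auto simp: smooth_map_open_def intro: continuous_open_preimage)
  moreover have "(\<one>\<^bsub>G\<^esub>, \<one>\<^bsub>G\<^esub>) \<in> W \<inter> m -` fst c" using W(1) m c(2) UN by simp
  ultimately obtain V1 V2 where V12: "open V1" "open V2" "\<one>\<^bsub>G\<^esub> \<in> V1" "\<one>\<^bsub>G\<^esub> \<in> V2"
      "V1 \<times> V2 \<subseteq> W \<inter> m -` fst c"
    by (metis open_prod_elim mem_Sigma_iff)
  \<comment> \<open>A single neighbourhood for both factors, contained in the chart domain, whose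
    products do not leave that domain.\<close>
  define V where "V = fst c \<inter> V1 \<inter> V2"
  have sub: "V \<times> V \<subseteq> fst ?C \<inter> W \<inter> m -` fst c" using V12(5) by (auto simp: V_def)
  have op: "open (snd c ` V)"
    using chart_image_open[OF c(1) open_Int[OF V12(1,2)]] by (simp add: V_def Int_assoc)
  have "smooth_on (snd c ` V \<times> snd c ` V) (snd c \<circ> m \<circ> chart_inv ?C)"
    by (rule smooth_on_subset[OF sm]) (use sub in force)
  then have "smooth_on (snd c ` V \<times> snd c ` V)
      (\<lambda>z. snd c (chart_inv c (fst z) \<otimes>\<^bsub>G\<^esub> chart_inv c (snd z)))"
  proof (rule smooth_on_cong[rotated 2])
    show "open (snd c ` V \<times> snd c ` V)" using op by (intro open_Times)
    fix z assume "z \<in> snd c ` V \<times> snd c ` V"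
    then obtain g h where gh: "g \<in> V" "h \<in> V" "z = (snd c g, snd c h)" by auto
    moreover have "(g, h) \<in> W" using sub gh by auto
    ultimately show "(snd c \<circ> m \<circ> chart_inv ?C) z
        = snd c (chart_inv c (fst z) \<otimes>\<^bsub>G\<^esub> chart_inv c (snd z))"
      using c(1) by (simp add: chart_inv_prod is_chart chart_image_def V_def m)
  qed
  moreover have "g \<otimes>\<^bsub>G\<^esub> h \<in> fst c" if "g \<in> V" "h \<in> V" for g h
  proof -
    have "(g, h) \<in> W \<inter> m -` fst c" using sub that by blast
    then show ?thesis using m by auto
  qed
  moreover have "open V" using V12 chart_open[OF c(1)] by (auto simp: V_def)
  moreover have "\<one>\<^bsub>G\<^esub> \<in> V" "V \<subseteq> fst c" using c(2) V12(3,4) by (auto simp: V_def)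
  ultimately show thesis using that by blast
qed

text \<open>The definition gives the value at \<open>g\<close> in the chart preferred at
  \<open>g\<close>. Changing to \<open>c\<close> cancels that choice by the cocycle rule and leaves
  the derivative of \<open>\<mu>\<close> in its second factor.\<close>

lemma left_invariant_in_chart:
  fixes \<A> :: "('g::{t2_space,second_countable_topology}, 'l::real_inner) atlas"
  assumes "lie_group \<A> G"
  defines "c \<equiv> chart_at \<A> \<one>\<^bsub>G\<^esub>"
  defines "\<mu> \<equiv> (\<lambda>z. snd c (chart_inv c (fst z) \<otimes>\<^bsub>G\<^esub> chart_inv c (snd z)))"
  assumes V: "open V" "\<one>\<^bsub>G\<^esub> \<in> V" "V \<subseteq> fst c" "\<And>g h. g \<in> V \<Longrightarrow> h \<in> V \<Longrightarrow> g \<otimes>\<^bsub>G\<^esub> h \<in> fst c"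
    and sm: "smooth_on (snd c ` V \<times> snd c ` V) \<mu>" and g: "g \<in> V"
  shows "vf_rep \<A> c (left_invariant \<A> G A) (snd c g)
    = frechet_derivative \<mu> (at (snd c g, snd c \<one>\<^bsub>G\<^esub>)) (0, A)"
proof -
  interpret smooth_mfd \<A> using assms(1) by (simp add: smooth_mfd_def lie_group_def)
  interpret group G using assms(1) by (simp add: lie_group_def)
  have UN: "carrier G = UNIV" using assms(1) by (simp add: lie_group_def)
  have c: "c \<in> \<A>" "\<one>\<^bsub>G\<^esub> \<in> fst c" "g \<in> fst c" using V(3) g by (auto simp: c_def chart_at)
  define d where "d = chart_at \<A> g"
  have d: "d \<in> \<A>" "g \<in> fst d" by (simp_all add: d_def chart_at)
  have g1: "g \<otimes>\<^bsub>G\<^esub> \<one>\<^bsub>G\<^esub> = g" using UN by simp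
  let ?x = "snd c \<one>\<^bsub>G\<^esub>"
  let ?D = "frechet_derivative \<mu> (at (snd c g, ?x))"
  have "(\<mu> has_derivative ?D) (at (snd c g, ?x))"
    by (rule smooth_onE(1)[OF sm]) (use g V in auto)
  moreover have "((\<lambda>y. (snd c g, y)) has_derivative (\<lambda>v. (0, v))) (at ?x)"
    by (auto intro!: derivative_eq_intros)
  ultimately have mu: "((\<lambda>y. \<mu> (snd c g, y)) has_derivative (\<lambda>v. ?D (0, v))) (at ?x)"
    using diff_chain_at[of "\<lambda>y. (snd c g, y)" "\<lambda>v. (0, v)" ?x \<mu> ?D] by (simp add: o_def)
  have "((snd d \<circ> chart_inv c) has_derivative coord_change c d g) (at (\<mu> (snd c g, ?x)))"
    using coord_change_has_derivative[OF c(1) d(1) c(3) d(2)] c g1 by (simp add: \<mu>_def)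
  note chain = diff_chain_at[OF mu this]
  have "(snd d \<circ> (\<lambda>h. g \<otimes>\<^bsub>G\<^esub> h) \<circ> chart_inv c has_derivative
      coord_change c d g \<circ> (\<lambda>v. ?D (0, v))) (at ?x)"
    by (rule has_derivative_in_chart[OF c(1,2) V(1,2) chain])
       (use c V(4)[OF g] in \<open>simp add: \<mu>_def\<close>)
  then have "left_invariant \<A> G A g = coord_change c d g (?D (0, A))"
    by (simp add: left_invariant_def tangent_map_def g1 c_def[symmetric] d_def[symmetric]
        frechet_derivative_eqI)
  then show ?thesis
    using c d by (simp add: vf_rep_apply d_def[symmetric] coord_change_compose coord_change_refl)
qed

lemma bounded_linear_lie_algebra_bracket:
  fixes \<A> :: "('g::{t2_space,second_countable_topology}, 'l::real_inner) atlas"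
  assumes "lie_group \<A> G"
  shows "bounded_linear (lie_algebra_bracket \<A> G A)"
proof -
  interpret smooth_mfd \<A> using assms(1) by (simp add: smooth_mfd_def lie_group_def)
  define c where "c = chart_at \<A> \<one>\<^bsub>G\<^esub>"
  define \<mu> where "\<mu> = (\<lambda>z. snd c (chart_inv c (fst z) \<otimes>\<^bsub>G\<^esub> chart_inv c (snd z)))"
  have c: "c \<in> \<A>" by (simp add: c_def chart_at)
  obtain V where V: "open V" "\<one>\<^bsub>G\<^esub> \<in> V" "V \<subseteq> fst c" "\<And>g h. g \<in> V \<Longrightarrow> h \<in> V \<Longrightarrow> g \<otimes>\<^bsub>G\<^esub> h \<in> fst c"
    and sm: "smooth_on (snd c ` V \<times> snd c ` V) \<mu>"
    using lie_group_mult_in_chart[OF assms] unfolding c_def \<mu>_def by blast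
  let ?x = "snd c \<one>\<^bsub>G\<^esub>"
  let ?S = "snd c ` V \<times> snd c ` V"
  have opV: "open (snd c ` V)"
    using chart_image_open[OF c V(1)] V(3) by (simp add: Int_absorb1)
  then have S: "open ?S" "(?x, ?x) \<in> ?S" using V(2) by (auto intro: open_Times)
  let ?D2 = "\<lambda>u. frechet_derivative (\<lambda>z. frechet_derivative \<mu> (at z) u) (at (?x, ?x))"
  have rep: "vf_rep \<A> c (left_invariant \<A> G B) y = frechet_derivative \<mu> (at (y, ?x)) (0, B)"
    if "y \<in> snd c ` V" for y B
    using that left_invariant_in_chart[OF assms, folded c_def, folded \<mu>_def, OF V sm] by auto
  \<comment> \<open>Symmetry of the second derivative moves \<open>B\<close> from the inner
    direction to the outer one, where the dependence is linear and bounded by the definition of a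
    derivative.\<close>
  have der: "frechet_derivative (vf_rep \<A> c (left_invariant \<A> G B)) (at ?x) v = ?D2 (v, 0) (0, B)" for B v
  proof -
    have "((\<lambda>z. frechet_derivative \<mu> (at z) (0, B)) has_derivative ?D2 (0, B)) (at (?x, ?x))"
      by (rule smooth_onE(1)[OF smooth_onE(2)[OF sm] S(2)])
    moreover have "((\<lambda>y. (y, ?x)) has_derivative (\<lambda>v. (v, 0))) (at ?x)"
      by (auto intro!: derivative_eq_intros)
    ultimately have "((\<lambda>y. frechet_derivative \<mu> (at (y, ?x)) (0, B)) has_derivative
        (\<lambda>v. ?D2 (0, B) (v, 0))) (at ?x)"
      using diff_chain_at[of "\<lambda>y. (y, ?x)" "\<lambda>v. (v, 0)" ?x "\<lambda>z. frechet_derivative \<mu> (at z) (0, B)"]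
      by (simp add: o_def)
    from has_derivative_transform_within_open[OF this opV, of "vf_rep \<A> c (left_invariant \<A> G B)"]
    have "(vf_rep \<A> c (left_invariant \<A> G B) has_derivative (\<lambda>v. ?D2 (0, B) (v, 0))) (at ?x)"
      using V(2) rep by auto
    then show ?thesis
      by (simp add: frechet_derivative_eqI symmetric_second_derivative[OF S sm])
  qed
  have at1: "left_invariant \<A> G B \<one>\<^bsub>G\<^esub> = frechet_derivative \<mu> (at (?x, ?x)) (0, B)" for B
    using rep[of ?x B] V(2) vf_rep_chart_at[of "\<one>\<^bsub>G\<^esub>"] by (simp add: c_def)
  have eq: "lie_algebra_bracket \<A> G A = (\<lambda>C. ?D2 (left_invariant \<A> G A \<one>\<^bsub>G\<^esub>, 0) (0, C)
      - frechet_derivative (vf_rep \<A> c (left_invariant \<A> G A)) (at ?x) (frechet_derivative \<mu> (at (?x, ?x)) (0, C)))"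
    unfolding lie_algebra_bracket_def lie_bracket_def Let_def c_def[symmetric] der at1 ..
  have pair: "bounded_linear (\<lambda>C::'l. (0::'l, C))"
    by (intro bounded_linear_Pair bounded_linear_zero bounded_linear_ident)
  \<comment> \<open>In this term the varying vector sits in the inner slot, so the symmetry is used
    in the opposite sense.\<close>
  have bl: "bounded_linear (\<lambda>v. ?D2 (v, 0) (0, A))"
  proof -
    have "bounded_linear (?D2 (0, A))"
      using smooth_onE(1)[OF smooth_onE(2)[OF sm] S(2)] has_derivative_bounded_linear by blast
    from bounded_linear_compose[OF this, of "\<lambda>v. (v, 0)"]
    show ?thesis
      by (simp add: symmetric_second_derivative[OF S sm, of "(0, A)"]
          bounded_linear_Pair bounded_linear_zero bounded_linear_ident)
  qed
  show ?thesis
    unfolding eq der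
    by (intro bounded_linear_sub bounded_linear_compose[OF _ pair] bounded_linear_compose[OF bl]
          has_derivative_bounded_linear[OF smooth_onE(1)[OF sm S(2)]]
          has_derivative_bounded_linear[OF smooth_onE(1)[OF smooth_onE(2)[OF sm] S(2)]])
qed

section \<open>Coframes\<close>

text \<open>A bounded operator instead of the bare \<open>inv_into\<close> of
  \<open>F_bundle\<close>, so that its dependence on the point can be differentiated in operator
  norm.\<close>

definition coframe_inv :: "('e::real_normed_vector \<Rightarrow>\<^sub>L 'l::real_normed_vector) \<Rightarrow> 'l \<Rightarrow>\<^sub>L 'e" where
  "coframe_inv w = Blinfun (inv_into UNIV (blinfun_apply w))"

definition F_map :: "('e::real_normed_vector \<Rightarrow>\<^sub>L 'l::real_normed_vector) \<Rightarrow> 'l ddual \<Rightarrow> 'e ddual" where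
  "F_map w a = (coframe_inv w (fst a), snd a o\<^sub>L w)"

locale coframe = smooth_mfd \<A>
  for \<A> :: "('m::{t2_space,second_countable_topology}, 'e::real_inner) atlas" +
  fixes \<omega> :: "'m \<Rightarrow> 'e \<Rightarrow>\<^sub>L 'l::real_inner"
  assumes finite_dim_l: "finite_dim TYPE('l)"
    and \<omega>_smooth: "smooth_form \<A> UNIV \<omega>"
    and \<omega>_bij: "bij (blinfun_apply (\<omega> u))"
begin

lemma coframe_inv_apply: "coframe_inv (\<omega> u) A = inv_into UNIV (\<omega> u) A"
proof -
  have "linear (inv_into UNIV (blinfun_apply (\<omega> u)))"
    using \<omega>_bij[of u]
    by (intro linearI; intro inv_into_f_eq[of _ UNIV])
       (auto simp: bij_is_inj bij_is_surj surj_f_inv_f blinfun.bilinear_simps)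
  then show ?thesis
    by (simp add: coframe_inv_def bounded_linear_Blinfun_apply finite_dim_bounded_linear[OF finite_dim_l])
qed

lemma coframe_inv [simp]: "\<omega> u (coframe_inv (\<omega> u) A) = A" "coframe_inv (\<omega> u) (\<omega> u v) = v"
  using \<omega>_bij[of u] by (simp_all add: coframe_inv_apply bij_is_surj surj_f_inv_f bij_is_inj)

lemma F_bundle_eq: "F_bundle \<omega> D u = F_map (\<omega> u) ` D"
  by (force simp: F_bundle_def F_map_def coframe_inv_apply)

lemma linear_F_map: "linear (F_map w)"
  by (rule linearI) (simp_all add: F_map_def blinfun.bilinear_simps bounded_bilinear.add_left
      bounded_bilinear.scaleR_left bounded_bilinear_blinfun_compose)

lemma pairing_F_map: "pairing (F_map (\<omega> u) a) (F_map (\<omega> u) b) = pairing a b"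
  by (simp add: pairing_def F_map_def)

lemma bij_F_map: "bij (F_map (\<omega> u))"
proof (rule bijI')
  show "F_map (\<omega> u) a = F_map (\<omega> u) b \<longleftrightarrow> a = b" for a b
  proof
    assume eq: "F_map (\<omega> u) a = F_map (\<omega> u) b"
    have "fst a = fst b" using eq coframe_inv(1) by (metis F_map_def fst_conv)
    moreover have "snd a v = snd b v" for v
      using eq by (metis F_map_def snd_conv blinfun_apply_blinfun_compose coframe_inv(1))
    ultimately show "a = b" by (simp add: prod_eq_iff blinfun_eqI)
  qed simp
  show "\<exists>a. b = F_map (\<omega> u) a" for b
    by (rule exI[of _ "(\<omega> u (fst b), snd b o\<^sub>L coframe_inv (\<omega> u))"])
       (auto simp: F_map_def prod_eq_iff intro!: blinfun_eqI)
qed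

text \<open>\<open>F_map (\<omega> u)\<close> is a linear bijection that preserves the pairing, so
  an isotropic space above the image of \<open>D\<close> pulls back to an isotropic space above
  \<open>D\<close>.\<close>

lemma maximal_isotropic_F_bundle:
  assumes D: "maximal_isotropic D"
  shows "maximal_isotropic (F_bundle \<omega> D u)"
proof -
  let ?F = "F_map (\<omega> u)"
  have inj: "inj ?F" and surj: "surj ?F" using bij_F_map[of u] by (auto simp: bij_def)
  have iso: "isotropic D" and max: "\<And>E. isotropic E \<Longrightarrow> D \<subseteq> E \<Longrightarrow> E = D"
    using D by (auto simp: maximal_isotropic_def)
  have "E = ?F ` D" if E: "isotropic E" "?F ` D \<subseteq> E" for E
  proof -
    have "isotropic (?F -` E)"
      using E(1) linear_subspace_vimage[OF linear_F_map]
      by (auto simp: isotropic_def) (metis pairing_F_map)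
    then have "?F -` E = D" using E(2) by (intro max) auto
    then show ?thesis using surj by (metis surj_image_vimage_eq)
  qed
  moreover have "isotropic (?F ` D)"
    using iso linear_subspace_image[OF linear_F_map] by (auto simp: isotropic_def pairing_F_map)
  ultimately show ?thesis by (auto simp: maximal_isotropic_def F_bundle_eq)
qed

text \<open>Defined by inverting the representative of \<open>\<omega>\<close>, not by transporting
  the inverse at each point: in this form smoothness follows from
  \<open>smooth_on_blinfun_inverse\<close>. The next lemma shows that both descriptions
  agree.\<close>

definition coframe_inv_rep :: "('m, 'e) chart \<Rightarrow> 'e \<Rightarrow> 'l \<Rightarrow>\<^sub>L 'e" where
  "coframe_inv_rep c x = coframe_inv (form_rep \<A> c \<omega> x)"

lemma coframe_inv_rep:
  assumes c: "c \<in> \<A>" "p \<in> fst c"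
  shows "coframe_inv_rep c (snd c p) A = coord_change (chart_at \<A> p) c p (coframe_inv (\<omega> p) A)"
proof -
  define J where "J = Blinfun (coord_change (chart_at \<A> p) c p) o\<^sub>L coframe_inv (\<omega> p)"
  have J: "J B = coord_change (chart_at \<A> p) c p (coframe_inv (\<omega> p) B)" for B
    by (simp add: J_def bounded_linear_Blinfun_apply bounded_linear_coord_change chart_at c)
  have "inv_into UNIV (form_rep \<A> c \<omega> (snd c p)) = blinfun_apply J"
    by (rule inv_equality)
       (simp_all add: J form_rep_apply[OF c] coord_change_compose coord_change_refl chart_at c)
  then show ?thesis
    by (simp add: coframe_inv_rep_def coframe_inv_def blinfun_apply_inverse J)
qed

lemma coframe_inv_rep_inverse:
  assumes "c \<in> \<A>" "x \<in> chart_image c"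
  shows "form_rep \<A> c \<omega> x (coframe_inv_rep c x A) = A" "coframe_inv_rep c x (form_rep \<A> c \<omega> x v) = v"
  using assms
  by (auto simp: chart_image_def coframe_inv_rep form_rep_apply coord_change_compose coord_change_refl chart_at)

lemma chart_image: "c \<in> \<A> \<Longrightarrow> open (chart_image c)"
  using is_chart by (simp add: is_chart_def)

lemma coframe_inv_rep_smooth: "c \<in> \<A> \<Longrightarrow> smooth_on (chart_image c) (coframe_inv_rep c)"
  by (rule smooth_on_blinfun_inverse[OF chart_image _ _ form_rep_smooth[OF \<omega>_smooth]])
     (auto intro!: blinfun_eqI simp: coframe_inv_rep_inverse)

section \<open>Constant sections and the subbundle property\<close>

lemma smooth_section_F_map: "smooth_section \<A> W (\<lambda>u. F_map (\<omega> u) a)" if "open W" for W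
proof -
  have "smooth_on (snd c ` (fst c \<inter> W)) (vf_rep \<A> c (\<lambda>u. fst (F_map (\<omega> u) a))) \<and>
    smooth_on (snd c ` (fst c \<inter> W)) (form_rep \<A> c (\<lambda>u. snd (F_map (\<omega> u) a)))" if c: "c \<in> \<A>" for c
  proof -
    have sub: "snd c ` (fst c \<inter> W) \<subseteq> chart_image c" by (auto simp: chart_image_def)
    have op: "open (snd c ` (fst c \<inter> W))" by (rule chart_image_open[OF c \<open>open W\<close>])
    have "smooth_on (snd c ` (fst c \<inter> W)) (vf_rep \<A> c (\<lambda>u. fst (F_map (\<omega> u) a)))"
      by (rule smooth_on_cong[OF op _ smooth_on_bounded_linear[OF op
              smooth_on_subset[OF coframe_inv_rep_smooth[OF c] sub] blinfun.bounded_linear_left[of "fst a"]]])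
         (auto simp: coframe_inv_rep vf_rep_apply c F_map_def)
    moreover have "smooth_on (snd c ` (fst c \<inter> W)) (form_rep \<A> c (\<lambda>u. snd (F_map (\<omega> u) a)))"
      by (rule smooth_on_cong[OF op _ smooth_on_bilinear[OF bounded_bilinear_blinfun_compose op
              smooth_on_const[OF op, of "snd a"] smooth_on_subset[OF form_rep_smooth[OF \<omega>_smooth c] sub]]])
         (auto intro!: blinfun_eqI simp: form_rep_apply c F_map_def)
    ultimately show ?thesis ..
  qed
  then show ?thesis by (simp add: smooth_section_def smooth_vector_field_def smooth_form_def)
qed

text \<open>Bounds the size of independent subsets of \<open>'l ddual\<close>, so that a basis of
  \<open>D\<close> is finite and can be indexed by natural numbers.\<close>

lemma finite_spanning_ddual:
  obtains S :: "'l ddual set" where "finite S" "span S = UNIV"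
proof -
  obtain B :: "'l set" where B: "finite B" "\<And>x. (\<Sum>b\<in>B. (x \<bullet> b) *\<^sub>R b) = x"
    using finite_dim_orthonormal_basis[OF finite_dim_l] by blast
  let ?S = "(\<lambda>b. (b, 0)) ` B \<union> (\<lambda>b. (0, blinfun_inner_left b)) ` B :: 'l ddual set"
  have "a \<in> span ?S" for a :: "'l ddual"
  proof -
    have 1: "(\<Sum>b\<in>B. (fst a \<bullet> b) *\<^sub>R (b, 0)) \<in> span ?S"
      by (intro span_sum span_scale span_base) auto
    have 2: "(\<Sum>b\<in>B. snd a b *\<^sub>R (0, blinfun_inner_left b)) \<in> span ?S"
      by (intro span_sum span_scale span_base) auto
    have "(\<Sum>b\<in>B. snd a b *\<^sub>R blinfun_inner_left b) = snd a"
      by (rule functional_orthonormal_expansion[OF B(2)])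
    then have "(\<Sum>b\<in>B. (fst a \<bullet> b) *\<^sub>R (b, 0)) + (\<Sum>b\<in>B. snd a b *\<^sub>R (0, blinfun_inner_left b)) = a"
      using B(2) by (simp add: prod_eq_iff fst_sum snd_sum)
    then show ?thesis using span_add[OF 1 2] by simp
  qed
  then have "span ?S = UNIV" by blast
  with _ show thesis by (rule that) (simp add: B(1))
qed

text \<open>A basis of \<open>D\<close>, carried to each fibre by \<open>F_map\<close>, is a global
  smooth frame; hence the neighbourhood is always \<open>UNIV\<close>.\<close>

lemma subbundle_F_bundle:
  assumes "subspace D"
  shows "subbundle \<A> (F_bundle \<omega> D)"
proof -
  obtain S :: "'l ddual set" where S: "finite S" "span S = UNIV" by (rule finite_spanning_ddual)
  obtain B where B: "B \<subseteq> D" "independent B" "D \<subseteq> span B" by (rule maximal_independent_subset[of D])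
  have spB: "span B = D" using B(1,3) assms by (simp add: span_minimal subset_antisym)
  have "finite B" using independent_span_bound[OF S(1) B(2)] S(2) by simp
  then obtain e where e: "bij_betw e {..<card B} B" by (metis atLeast0LessThan ex_bij_betw_nat_finite)
  then have eB: "e ` {..<card B} = B" "inj_on e {..<card B}" by (auto simp: bij_betw_def)
  have inj: "inj (F_map (\<omega> q))" for q using bij_F_map by (simp add: bij_def)
  have img: "(\<lambda>i. F_map (\<omega> q) (e i)) ` {..<card B} = F_map (\<omega> q) ` B" for q
    using eB(1) by (simp add: image_image[symmetric])
  have "inj_on (\<lambda>i. F_map (\<omega> q) (e i)) {..<card B}" for q
    using comp_inj_on[OF eB(2), of "F_map (\<omega> q)"] inj[of q] by (auto simp: o_def intro: inj_on_subset)
  moreover have "independent ((\<lambda>i. F_map (\<omega> q) (e i)) ` {..<card B})" for q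
    unfolding img by (rule linear_independent_injective_image[OF linear_F_map B(2)])
      (use inj in \<open>auto intro: inj_on_subset\<close>)
  moreover have "span ((\<lambda>i. F_map (\<omega> q) (e i)) ` {..<card B}) = F_bundle \<omega> D q" for q
    unfolding img F_bundle_eq by (simp add: linear_span_image[OF linear_F_map] spB)
  ultimately show ?thesis
    unfolding subbundle_def
    by (intro allI exI[of _ UNIV] exI[of _ "card B"] exI[of _ "\<lambda>i q. F_map (\<omega> q) (e i)"])
       (simp add: smooth_section_F_map)
qed

text \<open>
  Along a section \<open>F(a)\<close> of \<open>F(D)\<close> the coefficient \<open>a = A + \<alpha>\<close> is a function with values in \<open>D\<close>;
  by isotropy all of its directional derivatives are orthogonal to \<open>D\<close>.
\<close>

lemma section_coefficients:
  assumes iso: "isotropic D" and s: "section_of \<A> (F_bundle \<omega> D) s" and c: "c \<in> \<A>" "u \<in> fst c"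
    and a: "s u = F_map (\<omega> u) a"
  defines "x \<equiv> snd c u"
    and "X \<equiv> vf_rep \<A> c (\<lambda>q. fst (s q))" and "\<xi> \<equiv> form_rep \<A> c (\<lambda>q. snd (s q))"
    and "\<Omega> \<equiv> form_rep \<A> c \<omega>"
  obtains A' and \<alpha>' :: "'e \<Rightarrow> 'l \<Rightarrow>\<^sub>L real" where
    "\<And>v. \<Omega> x (frechet_derivative X (at x) v) = A' v - frechet_derivative \<Omega> (at x) v (X x)"
    "\<And>v w. frechet_derivative \<xi> (at x) v w = snd a (frechet_derivative \<Omega> (at x) v w) + \<alpha>' v (\<Omega> x w)"
    "\<And>v w. \<xi> x w = snd a (\<Omega> x w)" "\<Omega> x (X x) = fst a"
    "\<And>v e. e \<in> D \<Longrightarrow> snd e (A' v) + \<alpha>' v (fst e) = 0"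
proof -
  have X: "smooth_vector_field \<A> UNIV (\<lambda>q. fst (s q))" and \<xi>: "smooth_form \<A> UNIV (\<lambda>q. snd (s q))"
    using s by (auto simp: smooth_section_def section_of_def)
  have x: "x \<in> chart_image c" using c by (simp add: x_def chart_image_def)
  note dX = vf_rep_has_derivative[OF X c, folded X_def x_def]
  note d\<xi> = form_rep_has_derivative[OF \<xi> c, folded \<xi>_def x_def]
  note d\<Omega> = form_rep_has_derivative[OF \<omega>_smooth c, folded \<Omega>_def x_def]
  note dJ = smooth_onE(1)[OF coframe_inv_rep_smooth[OF c(1)] x]
  define J where "J = coframe_inv_rep c"
  \<comment> \<open>\<open>A\<close> and \<open>\<alpha>\<close> are the two components of the
    coefficient, written through representatives in \<open>c\<close> so that the product rule
    differentiates them. For \<open>\<alpha>\<close> this needs the derivative of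
    \<open>J\<close>.\<close>
  define A where "A y = \<Omega> y (X y)" for y
  define \<alpha> where "\<alpha> y = \<xi> y o\<^sub>L J y" for y
  note dA = bounded_bilinear.FDERIV[OF bounded_bilinear_blinfun_apply d\<Omega> dX, folded A_def]
  have coeff: "A (snd c q) = fst e" "\<alpha> (snd c q) = snd e"
    if q: "q \<in> fst c" "s q = F_map (\<omega> q) e" for q e
  proof -
    show "A (snd c q) = fst e"
      by (simp add: A_def \<Omega>_def X_def form_rep_vf_rep[OF c(1) q(1)] q(2) F_map_def)
    show "\<alpha> (snd c q) = snd e"
      by (rule blinfun_eqI) (simp add: \<alpha>_def \<xi>_def J_def form_rep_apply[OF c(1) q(1)] q c(1)
          coframe_inv_rep coord_change_compose coord_change_refl chart_at F_map_def)
  qed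
  have \<xi>_eq: "\<xi> y w = \<alpha> y (\<Omega> y w)" if "y \<in> chart_image c" for y w
    using that c(1) by (simp add: \<alpha>_def \<Omega>_def J_def coframe_inv_rep_inverse)
  obtain \<alpha>' where d\<alpha>: "(\<alpha> has_derivative \<alpha>') (at x)"
    unfolding \<alpha>_def J_def
    using bounded_bilinear.FDERIV[OF bounded_bilinear_blinfun_compose d\<xi> dJ] by blast
  have "\<Omega> x (frechet_derivative X (at x) v)
      = (\<Omega> x (frechet_derivative X (at x) v) + frechet_derivative \<Omega> (at x) v (X x))
        - frechet_derivative \<Omega> (at x) v (X x)" for v by simp
  moreover have "frechet_derivative \<xi> (at x) v w = snd a (frechet_derivative \<Omega> (at x) v w) + \<alpha>' v (\<Omega> x w)" for v w
  proof -
    have 1: "((\<lambda>y. \<xi> y w) has_derivative (\<lambda>v. frechet_derivative \<xi> (at x) v w)) (at x)"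
      by (rule bounded_linear.has_derivative[OF blinfun.bounded_linear_left d\<xi>])
    have "((\<lambda>y. \<alpha> y (\<Omega> y w)) has_derivative
        (\<lambda>v. \<alpha> x (frechet_derivative \<Omega> (at x) v w) + \<alpha>' v (\<Omega> x w))) (at x)"
      by (rule bounded_bilinear.FDERIV[OF bounded_bilinear_blinfun_apply d\<alpha>
            bounded_linear.has_derivative[OF blinfun.bounded_linear_left d\<Omega>]])
    then have 2: "((\<lambda>y. \<xi> y w) has_derivative
        (\<lambda>v. \<alpha> x (frechet_derivative \<Omega> (at x) v w) + \<alpha>' v (\<Omega> x w))) (at x)"
      by (rule has_derivative_transform_within_open[OF _ chart_image[OF c(1)] x]) (simp add: \<xi>_eq)
    show ?thesis
      using fun_cong[OF has_derivative_unique[OF 1 2], of v] coeff(2)[OF c(2) a] by (simp add: x_def)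
  qed
  moreover have "\<xi> x w = snd a (\<Omega> x w)" for w
    using \<xi>_eq[OF x] coeff(2)[OF c(2) a] by (simp add: x_def)
  moreover have "\<Omega> x (X x) = fst a"
    using coeff(1)[OF c(2) a] by (simp add: x_def A_def)
  moreover have "snd e (\<Omega> x (frechet_derivative X (at x) v) + frechet_derivative \<Omega> (at x) v (X x))
      + \<alpha>' v (fst e) = 0" if e: "e \<in> D" for v e
  proof -
    have "((\<lambda>y. snd e (A y) + \<alpha> y (fst e)) has_derivative
      (\<lambda>v. snd e (\<Omega> x (frechet_derivative X (at x) v) + frechet_derivative \<Omega> (at x) v (X x)) + \<alpha>' v (fst e))) (at x)"
      by (intro has_derivative_add bounded_linear.has_derivative[OF blinfun.bounded_linear_right dA]
          bounded_linear.has_derivative[OF blinfun.bounded_linear_left d\<alpha>])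
    \<comment> \<open>The element \<open>d\<close> of \<open>D\<close> is picked separately at each
      point, without any regularity; what is differentiated is the pairing with the fixed
      \<open>e\<close>, which is identically 0.\<close>
    moreover have "((\<lambda>y. snd e (A y) + \<alpha> y (fst e)) has_derivative (\<lambda>v. 0)) (at x)"
    proof (rule has_derivative_transform_within_open[OF has_derivative_const chart_image[OF c(1)] x])
      fix y assume "y \<in> chart_image c"
      then obtain q where q: "q \<in> fst c" "y = snd c q" by (auto simp: chart_image_def)
      have "s q \<in> F_map (\<omega> q) ` D" using s by (simp add: section_of_def F_bundle_eq)
      then obtain d where "d \<in> D" "s q = F_map (\<omega> q) d" by auto
      moreover from this have "pairing d e = 0" using iso e by (simp add: isotropic_def)
      ultimately show "0 = snd e (A y) + \<alpha> y (fst e)"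
        using coeff[OF q(1)] q(2) by (simp add: pairing_def)
    qed
    ultimately show ?thesis using has_derivative_unique by (metis (no_types, lifting))
  qed
  ultimately show thesis by (rule that)
qed

text \<open>The derivatives of the coefficients cancel in four pairs: \<open>a\<close> along
  \<open>Z\<close> against \<open>b\<close>, \<open>b\<close> along \<open>Z\<close> against
  \<open>a\<close>, \<open>a\<close> along \<open>Y\<close> against \<open>e\<close>, and
  \<open>b\<close> along \<open>X\<close> against \<open>e\<close>. Each derivative of
  \<open>\<omega>\<close> along \<open>Z\<close> occurs twice, which compensates the factor
  1/2.\<close>

lemma pairing_courant_bracket:
  assumes iso: "isotropic D"
    and s: "section_of \<A> (F_bundle \<omega> D) s" and t: "section_of \<A> (F_bundle \<omega> D) t"
    and D: "a \<in> D" "b \<in> D" "e \<in> D" and a: "s u = F_map (\<omega> u) a" and b: "t u = F_map (\<omega> u) b"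
  defines "X \<equiv> coframe_inv (\<omega> u) (fst a)" and "Y \<equiv> coframe_inv (\<omega> u) (fst b)"
    and "Z \<equiv> coframe_inv (\<omega> u) (fst e)"
  shows "pairing (courant_bracket \<A> s t u) (F_map (\<omega> u) e)
    = - (snd e (d_form \<A> \<omega> u X Y) + snd a (d_form \<A> \<omega> u Y Z) + snd b (d_form \<A> \<omega> u Z X))"
proof -
  \<comment> \<open>In the chart preferred at \<open>u\<close> representatives take the actual
    values at \<open>u\<close>, so no coordinate changes remain.\<close>
  define c where "c = chart_at \<A> u"
  have c: "c \<in> \<A>" "u \<in> fst c" by (simp_all add: c_def chart_at)
  define x where "x = snd c u"
  define Xf where "Xf = vf_rep \<A> c (\<lambda>q. fst (s q))"
  define Yf where "Yf = vf_rep \<A> c (\<lambda>q. fst (t q))"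
  define \<xi> where "\<xi> = form_rep \<A> c (\<lambda>q. snd (s q))"
  define \<eta> where "\<eta> = form_rep \<A> c (\<lambda>q. snd (t q))"
  define \<Omega> where "\<Omega> = form_rep \<A> c \<omega>"
  obtain A' and \<alpha>' :: "'e \<Rightarrow> 'l \<Rightarrow>\<^sub>L real" where s':
    "\<And>v. \<Omega> x (frechet_derivative Xf (at x) v) = A' v - frechet_derivative \<Omega> (at x) v (Xf x)"
    "\<And>v w. frechet_derivative \<xi> (at x) v w = snd a (frechet_derivative \<Omega> (at x) v w) + \<alpha>' v (\<Omega> x w)"
    "\<And>v w. \<xi> x w = snd a (\<Omega> x w)" "\<Omega> x (Xf x) = fst a"
    "\<And>v e. e \<in> D \<Longrightarrow> snd e (A' v) + \<alpha>' v (fst e) = 0"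
    using section_coefficients[OF iso s c a, folded x_def Xf_def \<xi>_def \<Omega>_def] by blast
  obtain B' and \<beta>' :: "'e \<Rightarrow> 'l \<Rightarrow>\<^sub>L real" where t':
    "\<And>v. \<Omega> x (frechet_derivative Yf (at x) v) = B' v - frechet_derivative \<Omega> (at x) v (Yf x)"
    "\<And>v w. frechet_derivative \<eta> (at x) v w = snd b (frechet_derivative \<Omega> (at x) v w) + \<beta>' v (\<Omega> x w)"
    "\<And>v w. \<eta> x w = snd b (\<Omega> x w)" "\<Omega> x (Yf x) = fst b"
    "\<And>v e. e \<in> D \<Longrightarrow> snd e (B' v) + \<beta>' v (fst e) = 0"
    using section_coefficients[OF iso t c b, folded x_def Yf_def \<eta>_def \<Omega>_def] by blast
  have at_u: "vf_rep \<A> c V x = V u" "form_rep \<A> c \<theta> x = \<theta> u"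
    for V and \<theta> :: "'m \<Rightarrow> 'e \<Rightarrow>\<^sub>L 'z::real_normed_vector"
    by (simp_all add: c_def x_def vf_rep_chart_at form_rep_chart_at)
  have XY: "Xf x = X" "Yf x = Y" and \<Omega>: "\<Omega> x = \<omega> u"
    by (simp_all add: Xf_def Yf_def \<Omega>_def at_u a b F_map_def X_def Y_def)
  have ss: "smooth_section \<A> UNIV s" "smooth_section \<A> UNIV t"
    using s t by (simp_all add: section_of_def)
  note courant = courant_bracket_rep[OF ss c, folded x_def Xf_def Yf_def \<xi>_def \<eta>_def, unfolded at_u]
  have dw: "d_form \<A> \<omega> u v w = frechet_derivative \<Omega> (at x) v w - frechet_derivative \<Omega> (at x) w v" for v w
    by (simp add: d_form_def Let_def c_def x_def \<Omega>_def)
  have Z: "\<Omega> x Z = fst e" "F_map (\<omega> u) e = (Z, snd e o\<^sub>L \<Omega> x)"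
    by (simp_all add: Z_def F_map_def \<Omega>)
  show ?thesis
    using s'(5)[OF D(2), of Z] t'(5)[OF D(1), of Z] s'(5)[OF D(3), of Y] t'(5)[OF D(3), of X]
    by (simp add: pairing_def Z courant blinfun.bilinear_simps s'(1-3) t'(1-3) s'(4)[unfolded XY]
        t'(4)[unfolded XY] XY dw field_simps)
qed

end

text \<open>The cyclic sums of \<open>\<kappa>\<close> and of the exterior derivative of
  \<open>\<omega>\<close> differ by the cyclic sum of the Lie bracket. That sum is the pairing of
  \<open>double_bracket\<close> of \<open>e\<^sub>1\<close> and \<open>e\<^sub>2\<close> with
  \<open>e\<^sub>3\<close>, and it vanishes since \<open>D\<close> is closed and isotropic.\<close>

lemma pairing_courant_bracket_curvature:
  fixes \<A>G :: "('g::{t2_space,second_countable_topology}, 'l::real_inner) atlas"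
  assumes "coframe \<A> \<omega>" and G: "lie_group \<A>G G" and D: "dirac_subalgebra \<A>G G D"
    and s: "section_of \<A> (F_bundle \<omega> D) s" and t: "section_of \<A> (F_bundle \<omega> D) t"
    and e: "e\<^sub>1 \<in> D" "e\<^sub>2 \<in> D" "e\<^sub>3 \<in> D"
    and s_u: "s u = F_map (\<omega> u) e\<^sub>1" and t_u: "t u = F_map (\<omega> u) e\<^sub>2"
  shows "pairing (courant_bracket \<A> s t u) (F_map (\<omega> u) e\<^sub>3)
    = - (pairing (curvature_K \<A>G G \<A> \<omega> u e\<^sub>1 e\<^sub>2) e\<^sub>3
       + pairing (curvature_K \<A>G G \<A> \<omega> u e\<^sub>2 e\<^sub>3) e\<^sub>1
       + pairing (curvature_K \<A>G G \<A> \<omega> u e\<^sub>3 e\<^sub>1) e\<^sub>2)"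
proof -
  interpret coframe \<A> \<omega> by fact
  let ?br = "lie_algebra_bracket \<A>G G"
  have iso: "isotropic D" and closed: "double_bracket \<A>G G e\<^sub>1 e\<^sub>2 \<in> D"
    using D e by (auto simp: dirac_subalgebra_def maximal_isotropic_def)
  have coad: "coad \<A>G G A \<zeta> C = - \<zeta> (?br A C)" for A \<zeta> C
    unfolding coad_def
    by (subst bounded_linear_Blinfun_apply)
       (intro bounded_linear_minus bounded_linear_compose[OF blinfun.bounded_linear_right]
         bounded_linear_lie_algebra_bracket[OF G], simp)
  have anti: "?br A B = - ?br B A" for A B
    by (simp add: lie_algebra_bracket_def lie_bracket_def Let_def)
  have "pairing (double_bracket \<A>G G e\<^sub>1 e\<^sub>2) e\<^sub>3 = 0"
    using iso closed e(3) by (simp add: isotropic_def)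
  then have "snd e\<^sub>3 (?br (fst e\<^sub>1) (fst e\<^sub>2)) + snd e\<^sub>1 (?br (fst e\<^sub>2) (fst e\<^sub>3))
      + snd e\<^sub>2 (?br (fst e\<^sub>3) (fst e\<^sub>1)) = 0"
    using anti[of "fst e\<^sub>3" "fst e\<^sub>1"]
    by (simp add: pairing_def double_bracket_def coad blinfun.bilinear_simps)
  then show ?thesis
    unfolding pairing_courant_bracket[OF iso s t e s_u t_u]
    by (simp add: pairing_def curvature_K_def
        curvature_def blinfun.bilinear_simps flip: coframe_inv_apply)
qed

theorem theorem4p2:
  fixes \<A>G :: "('g::{t2_space,second_countable_topology}, 'l::real_inner) atlas"
    and G :: "'g monoid" and P :: "'g set"
    and \<A>U :: "('u::{t2_space,second_countable_topology}, 'e::real_inner) atlas"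
    and \<A>M :: "('b::{t2_space,second_countable_topology}, 'f::real_inner) atlas"
    and \<pi> :: "'u \<Rightarrow> 'b" and R :: "'u \<Rightarrow> 'g \<Rightarrow> 'u"
    and \<omega> :: "'u \<Rightarrow> 'e \<Rightarrow>\<^sub>L 'l"
    and D :: "'l ddual set"
  assumes "cartan_geometry \<A>G G P \<A>U \<A>M \<pi> R \<omega>"
    and "dirac_subalgebra \<A>G G D"
  shows "dirac_structure \<A>U (F_bundle \<omega> D) \<longleftrightarrow>
    (\<forall>u. \<forall>e\<^sub>1\<in>D. \<forall>e\<^sub>2\<in>D. \<forall>e\<^sub>3\<in>D.
       pairing (curvature_K \<A>G G \<A>U \<omega> u e\<^sub>1 e\<^sub>2) e\<^sub>3
       + pairing (curvature_K \<A>G G \<A>U \<omega> u e\<^sub>2 e\<^sub>3) e\<^sub>1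
       + pairing (curvature_K \<A>G G \<A>U \<omega> u e\<^sub>3 e\<^sub>1) e\<^sub>2 = 0)"
    (is "_ \<longleftrightarrow> (\<forall>u. \<forall>e\<^sub>1\<in>D. \<forall>e\<^sub>2\<in>D. \<forall>e\<^sub>3\<in>D. ?cyc u e\<^sub>1 e\<^sub>2 e\<^sub>3 = 0)")
proof -
  have G: "lie_group \<A>G G"
    using assms(1) by (simp add: cartan_geometry_def)
  interpret coframe \<A>U \<omega>
    using assms(1)
    by unfold_locales
       (auto simp: cartan_geometry_def principal_bundle_def lie_group_def smooth_manifold_def)
  have max: "maximal_isotropic D" and sub: "subspace D"
    using assms(2) by (auto simp: dirac_subalgebra_def maximal_isotropic_def isotropic_def)
  note key = pairing_courant_bracket_curvature[OF coframe_axioms G assms(2)]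
  \<comment> \<open>Applied in the tangent fibres, not in \<open>D\<close>: membership of the
    bracket in \<open>F_bundle \<omega> D u\<close> becomes a test against all
    \<open>F_map (\<omega> u) e\<close>.\<close>
  note perp = maximal_isotropic_perp_iff[OF finite_dim maximal_isotropic_F_bundle[OF max]]
  show ?thesis
  proof
    assume dirac: "dirac_structure \<A>U (F_bundle \<omega> D)"
    show "\<forall>u. \<forall>e\<^sub>1\<in>D. \<forall>e\<^sub>2\<in>D. \<forall>e\<^sub>3\<in>D. ?cyc u e\<^sub>1 e\<^sub>2 e\<^sub>3 = 0"
    proof (intro allI ballI)
      fix u e\<^sub>1 e\<^sub>2 e\<^sub>3 assume e: "e\<^sub>1 \<in> D" "e\<^sub>2 \<in> D" "e\<^sub>3 \<in> D"
      let ?s = "\<lambda>e u. F_map (\<omega> u) e"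
      have sec: "section_of \<A>U (F_bundle \<omega> D) (?s e)" if "e \<in> D" for e
        using that by (simp add: section_of_def F_bundle_eq smooth_section_F_map)
      have "courant_bracket \<A>U (?s e\<^sub>1) (?s e\<^sub>2) u \<in> F_bundle \<omega> D u"
        using dirac sec[OF e(1)] sec[OF e(2)] by (auto simp: dirac_structure_def section_of_def)
      then have "pairing (courant_bracket \<A>U (?s e\<^sub>1) (?s e\<^sub>2) u) (F_map (\<omega> u) e\<^sub>3) = 0"
        using perp e(3) by (simp add: F_bundle_eq)
      then show "?cyc u e\<^sub>1 e\<^sub>2 e\<^sub>3 = 0"
        by (simp add: key[OF sec[OF e(1)] sec[OF e(2)] e refl refl])
    qed
  next
    assume cyc: "\<forall>u. \<forall>e\<^sub>1\<in>D. \<forall>e\<^sub>2\<in>D. \<forall>e\<^sub>3\<in>D. ?cyc u e\<^sub>1 e\<^sub>2 e\<^sub>3 = 0"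
    have "section_of \<A>U (F_bundle \<omega> D) (courant_bracket \<A>U s t)"
      if st: "section_of \<A>U (F_bundle \<omega> D) s" "section_of \<A>U (F_bundle \<omega> D) t" for s t
      unfolding section_of_def
    proof (intro conjI allI)
      show "smooth_section \<A>U UNIV (courant_bracket \<A>U s t)"
        using st by (intro smooth_section_courant_bracket) (simp_all add: section_of_def)
      fix u
      have "s u \<in> F_map (\<omega> u) ` D" "t u \<in> F_map (\<omega> u) ` D"
        using st by (simp_all add: section_of_def F_bundle_eq)
      then obtain e\<^sub>1 e\<^sub>2 where e: "e\<^sub>1 \<in> D" "e\<^sub>2 \<in> D" "s u = F_map (\<omega> u) e\<^sub>1" "t u = F_map (\<omega> u) e\<^sub>2"
        by blast
      have "pairing (courant_bracket \<A>U s t u) (F_map (\<omega> u) e\<^sub>3) = 0" if "e\<^sub>3 \<in> D" for e\<^sub>3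
        unfolding key[OF st e(1,2) that e(3,4)] using cyc e(1,2) that by simp
      then show "courant_bracket \<A>U s t u \<in> F_bundle \<omega> D u"
        unfolding perp by (auto simp: F_bundle_eq)
    qed
    then show "dirac_structure \<A>U (F_bundle \<omega> D)"
      by (simp add: dirac_structure_def subbundle_F_bundle[OF sub] maximal_isotropic_F_bundle[OF max])
  qed
qed

end
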